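(* Let $d\ge 1$, $\beta>0$, let $U:\mathbb{R}^d\to\mathbb{R}$ be a measurable external potential and $W\in L^\infty(\mathbb{R}^d)$ a symmetric ($W(-x)=W(x)$) interaction kernel, such that $\exp(-\beta E_N)\in L^1(\mathbb{R}^{Nd})$ for all $N\ge 2$. Let $\rho_N$ be the $N$-body Gibbs measure and $\mathcal{F}$ the mean-field free energy (both defined in the context). If $\beta<(2e\sqrt{2}\,\|W\|_\infty)^{-1}$, then for a minimizer $\rho$ of $\mathcal{F}$ over probability densities on $\mathbb{R}^d$ there exist a constant $C$ independent of $N$ and $N_0>0$ such that $$\mathcal{H}_N(\rho_N\mid\rho^{\otimes N})\le \frac{C}{N},\qquad \forall N>N_0.$$
   Context: For $N\ge2$ and $x_1,\dots,x_N\in\mathbb{R}^d$, the energy is $$E_N(x_1,\dots,x_N)=\sum_{i=1}^N U(x_i)+\frac{1}{2(N-1)}\sum_{i\ne j}W(x_i-x_j).$$ The $N$-body Gibbs measure is the probability measure on $\mathbb{R}^{Nd}$ with density $\rho_N=\bar Z_N^{-1}\exp(-\beta E_N)$, where $\bar Z_N=\int_{\mathbb{R}^{Nd}}\exp(-\beta E_N)$. The mean-field free energy of a probability density $\rho$ on $\mathbb{R}^d$ is $$\mathcal{F}(\rho)=\int_{\mathbb{R}^d}U\rho\,dx+\frac12\int_{\mathbb{R}^d}\rho\,(W*\rho)\,dx+\beta^{-1}\int_{\mathbb{R}^d}\rho\log\rho\,dx,$$ where $(W*\rho)(x)=\int W(x-y)\rho(y)\,dy$; the sum $\int (U\rho+\beta^{-1}\rho\log\rho)\,dx$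 is understood as a single integral, with values in $(-\infty,+\infty]$. The relative entropy is $\mathcal{H}(\mu\mid\nu)=\int\log\frac{d\mu}{d\nu}\,d\mu$ if $\mu\ll\nu$ and $+\infty$ otherwise. For probability measures on $(\mathbb{R}^d)^N$, $\mathcal{H}_N(\mu\mid\nu)=\frac1N\mathcal{H}(\mu\mid\nu)$. Here $\rho^{\otimes N}(x_1,\dots,x_N)=\prod_{i=1}^N\rho(x_i)$. The convention $1/0=+\infty$ is used if $\|W\|_\infty=0$. *)

theory Defs
  imports "HOL-Probability.Probability"
begin

text \<open>
  A single integral with values in the extended reals. It agrees with the Lebesgue integral
  for integrable \<open>f\<close>, and it is meaningful whenever the positive or the negative part of \<open>f\<close> has
  a finite integral. This is so in both uses below: for the free energy the negative part is
  integrable as soon as \<open>exp (- \<beta> U)\<close> is, and for the entropy see \<open>relative_entropy\<close>.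
\<close>
definition ext_integral :: "'a measure \<Rightarrow> ('a \<Rightarrow> real) \<Rightarrow> ereal" where
  "ext_integral M f =
     enn2ereal (\<integral>\<^sup>+ x. ennreal (f x) \<partial>M) - enn2ereal (\<integral>\<^sup>+ x. ennreal (- f x) \<partial>M)"

text \<open>\<open>\<parallel>W\<parallel>\<^sub>\<infinity>\<close>; since it takes values in \<^typ>\<open>ereal\<close>, the library's \<open>1 / 0 = \<infinity>\<close> applies to it.\<close>
definition Linf_norm :: "(real^'d \<Rightarrow> real) \<Rightarrow> ereal" where
  "Linf_norm W = esssup lebesgue (\<lambda>x. ereal \<bar>W x\<bar>)"

definition in_Linf :: "(real^'d \<Rightarrow> real) \<Rightarrow> bool" where
  "in_Linf W \<longleftrightarrow> W \<in> borel_measurable lebesgue \<and> Linf_norm W < \<infinity>"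

text \<open>
  Lebesgue measure on \<open>(\<real>\<^sup>d)\<^sup>N\<close>. A point is a function \<open>x\<close> on the indices \<open>0, \<dots>, N - 1\<close>; the
  completion makes Lebesgue measurable functions of the coordinates admissible.
\<close>
definition lebesgue_pow :: "nat \<Rightarrow> (nat \<Rightarrow> real^'d) measure" where
  "lebesgue_pow N = completion (Pi\<^sub>M {..<N} (\<lambda>_. lborel))"

definition energy ::
  "(real^'d \<Rightarrow> real) \<Rightarrow> (real^'d \<Rightarrow> real) \<Rightarrow> nat \<Rightarrow> (nat \<Rightarrow> real^'d) \<Rightarrow> real" where
  "energy U W N x =
     (\<Sum>i<N. U (x i)) + 1 / (2 * (real N - 1)) * (\<Sum>i<N. \<Sum>j\<in>{..<N} - {i}. W (x i - x j))"

definition partition_function ::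
  "real \<Rightarrow> (real^'d \<Rightarrow> real) \<Rightarrow> (real^'d \<Rightarrow> real) \<Rightarrow> nat \<Rightarrow> real" where
  "partition_function \<beta> U W N = (\<integral>x. exp (- \<beta> * energy U W N x) \<partial>lebesgue_pow N)"

definition gibbs_measure ::
  "real \<Rightarrow> (real^'d \<Rightarrow> real) \<Rightarrow> (real^'d \<Rightarrow> real) \<Rightarrow> nat \<Rightarrow> (nat \<Rightarrow> real^'d) measure" where
  "gibbs_measure \<beta> U W N =
     density (lebesgue_pow N)
       (\<lambda>x. ennreal (exp (- \<beta> * energy U W N x) / partition_function \<beta> U W N))"

definition tensor_measure :: "(real^'d \<Rightarrow> real) \<Rightarrow> nat \<Rightarrow> (nat \<Rightarrow> real^'d) measure" where
  "tensor_measure \<rho> N = density (lebesgue_pow N) (\<lambda>x. ennreal (\<Prod>i<N. \<rho> (x i)))"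

definition prob_density :: "(real^'d \<Rightarrow> real) \<Rightarrow> bool" where
  "prob_density \<rho> \<longleftrightarrow>
     \<rho> \<in> borel_measurable lebesgue \<and> (\<forall>x. 0 \<le> \<rho> x) \<and> (\<integral>\<^sup>+ x. ennreal (\<rho> x) \<partial>lebesgue) = 1"

definition conv :: "(real^'d \<Rightarrow> real) \<Rightarrow> (real^'d \<Rightarrow> real) \<Rightarrow> real^'d \<Rightarrow> real" where
  "conv W \<rho> x = (\<integral>y. W (x - y) * \<rho> y \<partial>lebesgue)"

text \<open>\<open>ln 0 = 0\<close> in the library, so \<open>\<rho> log \<rho>\<close> vanishes where \<open>\<rho>\<close> does, as it should.\<close>
definition free_energy ::
  "real \<Rightarrow> (real^'d \<Rightarrow> real) \<Rightarrow> (real^'d \<Rightarrow> real) \<Rightarrow> (real^'d \<Rightarrow> real) \<Rightarrow> ereal" where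
  "free_energy \<beta> U W \<rho> =
     ext_integral lebesgue (\<lambda>x. U x * \<rho> x + 1 / \<beta> * (\<rho> x * ln (\<rho> x)))
     + ereal (1 / 2 * (\<integral>x. \<rho> x * conv W \<rho> x \<partial>lebesgue))"

definition free_energy_minimizer ::
  "real \<Rightarrow> (real^'d \<Rightarrow> real) \<Rightarrow> (real^'d \<Rightarrow> real) \<Rightarrow> (real^'d \<Rightarrow> real) \<Rightarrow> bool" where
  "free_energy_minimizer \<beta> U W \<rho> \<longleftrightarrow>
     prob_density \<rho> \<and> (\<forall>\<sigma>. prob_density \<sigma> \<longrightarrow> free_energy \<beta> U W \<rho> \<le> free_energy \<beta> U W \<sigma>)"

text \<open>
  \<open>\<H>(\<mu> | \<nu>)\<close>. The argument order of the library is reversed: \<open>absolutely_continuous \<nu> \<mu>\<close> is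
  \<open>\<mu> \<lless> \<nu>\<close>, and \<open>RN_deriv \<nu> \<mu>\<close> is \<open>d\<mu>/d\<nu>\<close>. For probability measures the negative part of
  \<open>log d\<mu>/d\<nu>\<close> is always \<open>\<mu>\<close>-integrable. The library's \<open>KL_divergence\<close> is real valued and
  cannot take the value \<open>\<infinity>\<close>.
\<close>
definition relative_entropy :: "'a measure \<Rightarrow> 'a measure \<Rightarrow> ereal" where
  "relative_entropy \<mu> \<nu> =
     (if absolutely_continuous \<nu> \<mu>
      then ext_integral \<mu> (\<lambda>x. ln (enn2real (RN_deriv \<nu> \<mu> x)))
      else \<infinity>)"

definition scaled_relative_entropy :: "nat \<Rightarrow> 'a measure \<Rightarrow> 'a measure \<Rightarrow> ereal" where
  "scaled_relative_entropy N \<mu> \<nu> = relative_entropy \<mu> \<nu> / ereal (real N)"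

end

theory Submission
  imports Defs
begin

text \<open>
  Testing the minimality of \<open>\<rho>\<close> against the segment towards \<open>exp (- \<beta> (U + W * \<rho>)) / Z\<close> shows that
  \<open>\<rho>\<close> equals this density. Hence \<open>\<rho>\<^sub>N\<close> has a density proportional to \<open>exp g\<close> with respect to the
  tensor power of \<open>\<rho>\<close>, where \<open>g = - \<beta> / (2 (N - 1)) \<Sum> \<phi> (x\<^sub>i) (x\<^sub>j)\<close> and the kernel \<open>\<phi>\<close> has mean zero
  in each of its variables. By Jensen's inequality the relative entropy is at most \<open>ln M / \<delta>\<close>,
  where \<open>M\<close> is the expectation of \<open>exp ((1 + \<delta>) g)\<close> under the tensor power.

  To bound \<open>M\<close> uniformly in \<open>N\<close>, expand the exponential and the powers of the sum. Only those
  products of \<open>k\<close> kernels survive in which no index occurs exactly once. There are at most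
  \<open>(2 k)! (e\<^sup>r - r)\<^sup>N / r\<^sup>2\<^sup>k\<close> of them for each \<open>r > 0\<close>. Since \<open>e\<^sup>r - r \<le> exp (9/10 r\<^sup>2)\<close>, the choice
  \<open>r\<^sup>2 = k / (9/10 N)\<close> leaves a power series that converges for \<open>36/5 \<beta> \<parallel>W\<parallel>\<^sub>\<infinity> < 1\<close> and \<open>\<delta>\<close> small.
  The hypothesis on \<open>\<beta>\<close> suffices because \<open>36/5 < 2 e \<surd>2\<close>.
\<close>

subsection \<open>Maps without singleton fibres\<close>

text \<open>\<open>M\<close> will be the set of endpoint slots in a product of kernels and
  \<open>I\<close> the set of particle indices. Empty fibres are allowed. Extensional maps are used
  so that the set is finite and each map is counted once.\<close>

definition no_singles :: "'i set \<Rightarrow> 'm set \<Rightarrow> ('m \<Rightarrow> 'i) set" where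
  "no_singles I M = {f \<in> M \<rightarrow>\<^sub>E I. \<forall>i\<in>I. card {m\<in>M. f m = i} \<noteq> 1}"

lemma finite_no_singles: "finite I \<Longrightarrow> finite M \<Longrightarrow> finite (no_singles I M)"
  unfolding no_singles_def by (rule finite_subset[of _ "M \<rightarrow>\<^sub>E I"]) (auto intro: finite_PiE)

lemma sum_Pow_card:
  fixes h :: "nat \<Rightarrow> real"
  assumes "finite M"
  shows "(\<Sum>S\<in>Pow M. h (card S)) = (\<Sum>j\<le>card M. real (card M choose j) * h j)"
proof -
  have "(\<Sum>S\<in>Pow M. h (card S)) = (\<Sum>j\<le>card M. \<Sum>S\<in>{S\<in>Pow M. card S = j}. h (card S))"
    using assms by (intro sum.group[symmetric]) (auto intro: card_mono)
  also have "\<dots> = (\<Sum>j\<le>card M. real (card M choose j) * h j)"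
    by (intro sum.cong) (use n_subsets[OF assms] in auto)
  finally show ?thesis .
qed

lemma sum_without_linear_le_exp:
  fixes r :: real
  assumes "r \<ge> 0"
  shows "(\<Sum>j\<le>m. if j = 1 then 0 else r ^ j / fact j) \<le> exp r - r"
proof -
  have *: "(\<lambda>j. r ^ j / fact j) sums exp r"
    using exp_converges[of r] by (simp add: field_simps scaleR_conv_of_real)
  \<comment> \<open>The range is extended so that it contains the index 1 and the whole linear term
    can be split off.\<close>
  have "(\<Sum>j\<le>m. if j = 1 then 0 else r ^ j / fact j) \<le>
      (\<Sum>j\<le>max m 1. if j = 1 then 0 else r ^ j / fact j)"
    using assms by (intro sum_mono2) auto
  also have "\<dots> = (\<Sum>j\<le>max m 1. r ^ j / fact j - (if j = 1 then r else 0))"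
    by (intro sum.cong) auto
  also have "\<dots> = (\<Sum>j\<le>max m 1. r ^ j / fact j) - r"
    by (simp add: sum_subtractf)
  also have "(\<Sum>j\<le>max m 1. r ^ j / fact j) \<le> exp r"
    using assms sum_le_suminf[OF sums_summable[OF *], of "{..max m 1}"] sums_unique[OF *] by auto
  finally show ?thesis by simp
qed

text \<open>
  The bound is the coefficient estimate for \<open>(e\<^sup>z - z)\<^sup>|I|\<close>, the exponential generating
  function of such maps.
\<close>
lemma card_no_singles_le:
  fixes r :: real
  assumes "finite I" "finite M" "r > 0"
  shows "real (card (no_singles I M)) \<le> fact (card M) * (exp r - r) ^ card I / r ^ card M"
  using assms(1,2)
proof (induction I arbitrary: M)
  case empty
  show ?case
  proof (cases "M = {}")
    case True then show ?thesis by (auto simp: no_singles_def)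
  next
    case False
    then have "M \<rightarrow>\<^sub>E {} = ({} :: ('b \<Rightarrow> 'a) set)" by (auto simp: PiE_eq_empty_iff)
    then show ?thesis using assms(3) by (simp add: no_singles_def)
  qed
next
  case (insert i I)
  define E where "E = (exp r - r) ^ card I"
  have E: "E \<ge> 0" unfolding E_def using exp_ge_add_one_self[of r] by (intro zero_le_power) linarith
  let ?m = "card M"
  \<comment> \<open>A map is split by its fibre \<open>S\<close> over the new index
    \<open>i\<close>, which cannot be a singleton. What remains is a map of the same kind from
    \<open>M - S\<close> to \<open>I\<close>, and \<open>ext\<close> puts the two pieces together
    again.\<close>
  define P where "P = {S \<in> Pow M. card S \<noteq> 1}"
  define ext where "ext S g m = (if m \<in> S then i else g m)" for S and g :: "'b \<Rightarrow> 'a" and m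
  have fin: "finite P" unfolding P_def using insert.prems by auto
  have "no_singles (insert i I) M \<subseteq> (\<Union>S\<in>P. ext S ` no_singles I (M - S))"
  proof
    fix f assume f: "f \<in> no_singles (insert i I) M"
    define S where "S = {m\<in>M. f m = i}"
    define g where "g = restrict f (M - S)"
    have "S \<in> P" using f by (auto simp: P_def S_def no_singles_def)
    moreover have "f = ext S g"
      using f by (auto simp: ext_def g_def S_def no_singles_def fun_eq_iff PiE_def extensional_def)
    moreover have "g \<in> no_singles I (M - S)"
    proof -
      have "{m \<in> M - S. g m = j} = {m\<in>M. f m = j}" if "j \<in> I" for j
        using that insert.hyps by (auto simp: g_def S_def)
      then show ?thesis using f by (auto simp: no_singles_def g_def S_def)
    qed
    ultimately show "f \<in> (\<Union>S\<in>P. ext S ` no_singles I (M - S))" by blast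
  qed
  then have "card (no_singles (insert i I) M) \<le> card (\<Union>S\<in>P. ext S ` no_singles I (M - S))"
    using fin insert by (intro card_mono) (auto intro: finite_no_singles)
  also have "\<dots> \<le> (\<Sum>S\<in>P. card (ext S ` no_singles I (M - S)))"
    using fin by (rule card_UN_le)
  also have "\<dots> \<le> (\<Sum>S\<in>P. card (no_singles I (M - S)))"
    using insert by (intro sum_mono card_image_le finite_no_singles) auto
  finally have "real (card (no_singles (insert i I) M)) \<le> (\<Sum>S\<in>P. real (card (no_singles I (M - S))))"
    by (metis of_nat_mono of_nat_sum)
  also have "\<dots> \<le> (\<Sum>S\<in>P. fact (?m - card S) * E / r ^ (?m - card S))"
  proof (rule sum_mono)
    fix S assume S: "S \<in> P"
    then have "S \<subseteq> M" by (auto simp: P_def)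
    moreover then have "card (M - S) = ?m - card S"
      using insert.prems finite_subset by (intro card_Diff_subset) auto
    ultimately show "real (card (no_singles I (M - S))) \<le> fact (?m - card S) * E / r ^ (?m - card S)"
      using insert.IH[of "M - S"] insert.prems by (simp add: E_def)
  qed
  also have "\<dots> = (\<Sum>S\<in>Pow M. if card S = 1 then 0 else fact (?m - card S) * E / r ^ (?m - card S))"
    unfolding P_def using insert.prems by (subst sum.inter_filter) (auto intro!: sum.cong)
  also have "\<dots> = (\<Sum>j\<le>?m. real (?m choose j) * (if j = 1 then 0 else fact (?m - j) * E / r ^ (?m - j)))"
    by (rule sum_Pow_card[OF insert.prems])
  \<comment> \<open>The binomial coefficient times the factorial of m - j is m! / j!. This is how
    exponential generating functions multiply.\<close>
  also have "\<dots> = fact ?m * E / r ^ ?m * (\<Sum>j\<le>?m. if j = 1 then 0 else r ^ j / fact j)"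
    unfolding sum_distrib_left
    by (intro sum.cong) (use assms(3) in \<open>auto simp: binomial_fact power_diff field_simps\<close>)
  also have "\<dots> \<le> fact ?m * E / r ^ ?m * (exp r - r)"
    using E assms(3) by (intro mult_left_mono sum_without_linear_le_exp) auto
  also have "\<dots> = fact ?m * (exp r - r) ^ card (insert i I) / r ^ ?m"
    using insert.hyps by (simp add: E_def)
  finally show ?case .
qed

section \<open>Elementary bounds for exponentials and factorials\<close>

lemma exp_minus_self_le:
  fixes r :: real
  assumes "r \<ge> 0"
  shows "exp r - r \<le> exp (9/10 * r\<^sup>2)"
\<comment> \<open>Beyond 10/9 the exponent r is already below 9/10 r^2. Up to 10/9, the Taylor
  expansion of order four is compared with 1 + y + y^2 / 2 at y = 9/10 r^2. The factor 9/10 is small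
  enough that 8 * 9/10 = 36/5 stays below 2 e sqrt 2.\<close>
proof (cases "r \<le> 10/9")
  case False
  then have "r * 1 \<le> r * (9/10 * r)" by (intro mult_left_mono) auto
  then have "exp r \<le> exp (9/10 * r\<^sup>2)" by (simp add: power2_eq_square)
  then show ?thesis using assms by linarith
next
  case True
  obtain t where t: "\<bar>t\<bar> \<le> \<bar>r\<bar>" "exp r = (\<Sum>m<4. r ^ m / fact m) + exp t / fact 4 * r ^ 4"
    using Maclaurin_exp_le[of r 4] by auto
  have "exp t \<le> exp (10/9)" using t True assms by simp
  also have "\<dots> \<le> 5"
  proof -
    have "exp (10/9::real) = exp 1 * exp (1/9)" by (simp flip: exp_add)
    also have "\<dots> \<le> 3 * (1 + 1/9 + (1/9)\<^sup>2)" using exp_bound[of "1/9"] exp_le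
      by (intro mult_mono) auto
    also have "\<dots> \<le> 5" by (simp add: power2_eq_square)
    finally show ?thesis .
  qed
  finally have e: "exp t \<le> 5" .
  have "exp r - r = 1 + r\<^sup>2 / 2 + r ^ 3 / 6 + exp t / 24 * r ^ 4"
    using t by (simp add: numeral_eq_Suc fact_numeral)
  also have "\<dots> = 1 + r\<^sup>2 * (1/2 + r / 6 + exp t / 24 * r\<^sup>2)"
    by (simp add: algebra_simps power2_eq_square power4_eq_xxxx power3_eq_cube)
  also have "\<dots> \<le> 1 + r\<^sup>2 * (9/10 + 9/10*9/10/2 * r\<^sup>2)"
  proof -
    have "exp t / 24 * r\<^sup>2 \<le> 5 / 24 * r\<^sup>2" using e by (intro mult_right_mono) auto
    moreover have "r / 6 \<le> 10/9/6" using True by simp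
    ultimately have "1/2 + r / 6 + exp t / 24 * r\<^sup>2 \<le> 9/10 + 9/10*9/10/2 * r\<^sup>2"
      using zero_le_power2[of r] by linarith
    then show ?thesis by (intro add_left_mono mult_left_mono) auto
  qed
  also have "\<dots> \<le> exp (9/10 * r\<^sup>2)"
    using exp_lower_Taylor_quadratic[of "9/10 * r\<^sup>2"] by (simp add: power2_eq_square algebra_simps)
  finally show ?thesis .
qed

text \<open>A weak form of Stirling's formula; the linear prefactor does not affect the radius of
  convergence later. The induction step amounts to e \<le> (1 + 1/n)^(n+1), which comes from 1 - x
  \<le> exp (-x) at x = 1/(n+1).\<close>

lemma fact_le_exp_bound: "k \<ge> 1 \<Longrightarrow> fact k \<le> exp 1 * real k * (real k / exp 1) ^ k"
proof (induction k rule: nat_induct_at_least)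
  case base then show ?case by simp
next
  case (Suc n)
  have n: "real n > 0" using Suc by simp
  have "exp 1 \<le> (1 + 1 / real n) ^ Suc n"
  proof -
    have "1 - 1 / real (Suc n) \<le> exp (- (1 / real (Suc n)))" using exp_ge_add_one_self[of "- (1 / real (Suc n))"] by simp
    then have "exp (1 / real (Suc n)) \<le> 1 / (1 - 1 / real (Suc n))"
      using n by (simp add: exp_minus field_simps)
    also have "\<dots> = 1 + 1 / real n" using n by (simp add: field_simps)
    finally have "exp (1 / real (Suc n)) ^ Suc n \<le> (1 + 1 / real n) ^ Suc n" by (intro power_mono) auto
    moreover have "exp (1 / real (Suc n)) ^ Suc n = exp 1"
      by (subst exp_of_nat_mult[symmetric]) simp
    ultimately show ?thesis by simp
  qed
  then have "(real n / exp 1) ^ Suc n * exp 1 \<le> (real n / exp 1) ^ Suc n * (1 + 1 / real n) ^ Suc n"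
    using n by (intro mult_left_mono) auto
  also have "\<dots> = (real (Suc n) / exp 1) ^ Suc n"
  proof -
    have "real n / exp 1 * (1 + 1 / real n) = real (Suc n) / exp 1"
      using n by (simp add: field_simps)
    then show ?thesis by (metis power_mult_distrib)
  qed
  finally have *: "real n * (real n / exp 1) ^ n \<le> (real (Suc n) / exp 1) ^ Suc n" by simp
  have "fact (Suc n) = real (Suc n) * fact n" by simp
  also have "\<dots> \<le> real (Suc n) * (exp 1 * real n * (real n / exp 1) ^ n)"
    using Suc by (intro mult_left_mono) auto
  also have "\<dots> \<le> real (Suc n) * (exp 1 * (real (Suc n) / exp 1) ^ Suc n)"
    unfolding mult.assoc by (intro mult_left_mono *) auto
  finally show ?case by (simp add: mult_ac)
qed

text \<open>The quotient is the central binomial coefficient, at most 4^k, times k!.\<close>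

lemma fact_double_div_fact_le:
  assumes "k \<ge> 1"
  shows "fact (2 * k) / fact k \<le> exp 1 * real k * (4 * real k / exp 1) ^ k"
proof -
  have "(2 * k choose k) \<le> 2 ^ (2 * k)"
    by (rule binomial_le_pow2)
  then have c: "real (2 * k choose k) \<le> 4 ^ k"
    by (metis of_nat_le_iff of_nat_numeral of_nat_power power_mult power2_eq_square numeral_times_numeral semiring_norm(12,13) num_double)
  have "fact (2 * k) / fact k = real (2 * k choose k) * fact k"
    by (simp add: binomial_fact mult_2)
  also have "\<dots> \<le> 4 ^ k * (exp 1 * real k * (real k / exp 1) ^ k)"
    using c fact_le_exp_bound[OF assms] by (intro mult_mono) auto
  finally show ?thesis by (simp add: power_mult_distrib power_divide mult_ac)
qed

subsection \<open>Exponential moments of degenerate pair sums\<close>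

lemma (in prob_space) integrable_bounded:
  fixes f :: "'a \<Rightarrow> real"
  assumes "f \<in> borel_measurable M" "\<And>x. x \<in> space M \<Longrightarrow> \<bar>f x\<bar> \<le> K"
  shows "integrable M f"
  using assms by (intro integrable_const_bound[where B = K]) auto

lemma (in prob_space) abs_integral_le_const:
  fixes f :: "'a \<Rightarrow> real"
  assumes "f \<in> borel_measurable M" "\<And>x. x \<in> space M \<Longrightarrow> \<bar>f x\<bar> \<le> K"
  shows "\<bar>\<integral>x. f x \<partial>M\<bar> \<le> K"
proof -
  have i: "integrable M f" by (rule integrable_bounded) fact+
  have "\<bar>\<integral>x. f x \<partial>M\<bar> \<le> (\<integral>x. \<bar>f x\<bar> \<partial>M)" by (rule integral_abs_bound)
  also have "\<dots> \<le> (\<integral>x. K \<partial>M)" using i assms(2) by (intro integral_mono) auto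
  finally show ?thesis by (simp add: prob_space)
qed

text \<open>Degeneracy in the sense of U-statistics. The bound and the vanishing means are required
  at every point, so that they can be applied inside iterated integrals. Symmetry is not assumed,
  hence one condition for each argument.\<close>

locale degenerate_kernel = prob_space D for D :: "'a measure" +
  fixes \<phi> :: "'a \<Rightarrow> 'a \<Rightarrow> real" and B :: real
  assumes kernel_measurable: "case_prod \<phi> \<in> borel_measurable (D \<Otimes>\<^sub>M D)"
    and kernel_bound: "x \<in> space D \<Longrightarrow> y \<in> space D \<Longrightarrow> \<bar>\<phi> x y\<bar> \<le> B"
    and kernel_left: "y \<in> space D \<Longrightarrow> (\<integral>x. \<phi> x y \<partial>D) = 0"
    and kernel_right: "x \<in> space D \<Longrightarrow> (\<integral>y. \<phi> x y \<partial>D) = 0"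
begin

lemma kernel_component_measurable:
  "a \<in> I \<Longrightarrow> b \<in> I \<Longrightarrow> (\<lambda>x. \<phi> (x a) (x b)) \<in> borel_measurable (Pi\<^sub>M I (\<lambda>_. D))"
  using measurable_compose[OF _ kernel_measurable, of "\<lambda>x. (x a, x b)" "Pi\<^sub>M I (\<lambda>_. D)"] by simp

lemma kernel_component_bound:
  "a \<in> I \<Longrightarrow> b \<in> I \<Longrightarrow> x \<in> space (Pi\<^sub>M I (\<lambda>_. D)) \<Longrightarrow> \<bar>\<phi> (x a) (x b)\<bar> \<le> B"
  by (intro kernel_bound) (auto simp: space_PiM)

lemma B_nonneg: "B \<ge> 0"
  using not_empty kernel_bound by (meson abs_ge_zero all_not_in_conv order_trans)

text \<open>Integrate over the coordinate \<open>i\<close> first. Every factor except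
  \<open>l0\<close> is constant in it, and the factor \<open>l0\<close> has mean zero in whichever
  slot holds \<open>i\<close>. Distinct endpoints ensure that \<open>i\<close> fills only one of the
  two slots.\<close>

lemma integral_edges_eq_0:
  assumes fin: "finite I" "finite L" and i: "i \<in> I"
    and g: "\<And>l. l \<in> L \<Longrightarrow> g l \<in> I \<times> I" "\<And>l. l \<in> L \<Longrightarrow> fst (g l) \<noteq> snd (g l)"
    and l0: "l0 \<in> L" "i = fst (g l0) \<or> i = snd (g l0)"
    and l: "\<And>l. l \<in> L \<Longrightarrow> l \<noteq> l0 \<Longrightarrow> i \<noteq> fst (g l) \<and> i \<noteq> snd (g l)"
  shows "(\<integral>x. (\<Prod>l\<in>L. \<phi> (x (fst (g l))) (x (snd (g l)))) \<partial>Pi\<^sub>M I (\<lambda>_. D)) = 0"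
proof -
  interpret PI: prob_space "Pi\<^sub>M I (\<lambda>_. D)" by (rule prob_space_PiM) (rule prob_space_axioms)
  interpret P: product_sigma_finite "\<lambda>_. D" by standard
  define J where "J = I - {i}"
  have J: "I = insert i J" "i \<notin> J" "finite J" using i fin by (auto simp: J_def)
  define F where "F x = (\<Prod>l\<in>L. \<phi> (x (fst (g l))) (x (snd (g l))))" for x
  have gI: "fst (g l) \<in> I" "snd (g l) \<in> I" if "l \<in> L" for l using g(1)[OF that] by auto
  have "integrable (Pi\<^sub>M I (\<lambda>_. D)) F"
  proof (rule PI.integrable_bounded[where K = "B ^ card L"])
    show "F \<in> borel_measurable (Pi\<^sub>M I (\<lambda>_. D))" unfolding F_def
      by (intro borel_measurable_prod kernel_component_measurable gI)
    show "\<bar>F x\<bar> \<le> B ^ card L" if "x \<in> space (Pi\<^sub>M I (\<lambda>_. D))" for x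
      unfolding F_def abs_prod
      using prod_mono[of L "\<lambda>l. \<bar>\<phi> (x (fst (g l))) (x (snd (g l)))\<bar>" "\<lambda>_. B"]
      by (simp add: kernel_component_bound[OF _ _ that] gI)
  qed
  then have "(\<integral>x. F x \<partial>Pi\<^sub>M I (\<lambda>_. D)) = (\<integral>x. (\<integral>y. F (x(i := y)) \<partial>D) \<partial>Pi\<^sub>M J (\<lambda>_. D))"
    unfolding J(1) using J by (subst P.product_integral_insert) auto
  also have "\<dots> = (\<integral>x. 0 \<partial>Pi\<^sub>M J (\<lambda>_. D))"
  proof (rule Bochner_Integration.integral_cong[OF refl])
    fix x assume x: "x \<in> space (Pi\<^sub>M J (\<lambda>_. D))"
    define R where "R = (\<Prod>l\<in>L - {l0}. \<phi> (x (fst (g l))) (x (snd (g l))))"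
    have F: "F (x(i := y)) = \<phi> ((x(i := y)) (fst (g l0))) ((x(i := y)) (snd (g l0))) * R" for y
      unfolding F_def R_def using l0(1) fin(2)
      by (subst prod.remove[of _ l0]) (auto intro!: prod.cong dest!: l)
    show "(\<integral>y. F (x(i := y)) \<partial>D) = 0"
    proof (cases "i = fst (g l0)")
      case True
      then have "snd (g l0) \<in> J" using g[OF l0(1)] gI[OF l0(1)] by (auto simp: J_def)
      then have "x (snd (g l0)) \<in> space D" using x by (auto simp: space_PiM)
      then show ?thesis using True g(2)[OF l0(1)] unfolding F by (simp add: kernel_left)
    next
      case False
      then have "fst (g l0) \<in> J" using gI[OF l0(1)] by (auto simp: J_def)
      then have "x (fst (g l0)) \<in> space D" using x by (auto simp: space_PiM)
      then show ?thesis using False l0(2) unfolding F by (simp add: kernel_right)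
    qed
  qed
  finally show ?thesis by (simp add: F_def)
qed

section \<open>Sums of the kernel over pairs of distinct indices\<close>

definition edges :: "'i set \<Rightarrow> ('i \<times> 'i) set" where
  "edges I = {p \<in> I \<times> I. fst p \<noteq> snd p}"

text \<open>The pairs are ordered, so each unordered pair occurs twice, as in the double sum of the
  energy.\<close>

definition pair_sum :: "'i set \<Rightarrow> ('i \<Rightarrow> 'a) \<Rightarrow> real" where
  "pair_sum I x = (\<Sum>p\<in>edges I. \<phi> (x (fst p)) (x (snd p)))"

lemma finite_edges: "finite I \<Longrightarrow> finite (edges I)"
  unfolding edges_def by (rule finite_subset[of _ "I \<times> I"]) auto

lemma edgesD: "p \<in> edges I \<Longrightarrow> fst p \<in> I \<and> snd p \<in> I \<and> fst p \<noteq> snd p"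
  by (auto simp: edges_def)

lemma pair_sum_measurable: "pair_sum I \<in> borel_measurable (Pi\<^sub>M I (\<lambda>_. D))"
  unfolding pair_sum_def by (intro borel_measurable_sum kernel_component_measurable) (auto dest: edgesD)

lemma pair_sum_integral:
  assumes fin: "finite I"
  shows "(\<integral>x. pair_sum I x \<partial>Pi\<^sub>M I (\<lambda>_. D)) = 0"
proof -
  interpret PI: prob_space "Pi\<^sub>M I (\<lambda>_. D)" by (rule prob_space_PiM) (rule prob_space_axioms)
  \<comment> \<open>A single kernel is a product over a one-element set, and the first endpoint of
    its edge is an index that occurs once.\<close>
  have "(\<integral>x. \<phi> (x (fst p)) (x (snd p)) \<partial>Pi\<^sub>M I (\<lambda>_. D)) = 0" if "p \<in> edges I" for p
    using integral_edges_eq_0[OF fin, of "{()}" "fst p" "\<lambda>_. p" "()"] edgesD[OF that]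
    by (simp add: mem_Times_iff)
  moreover have "integrable (Pi\<^sub>M I (\<lambda>_. D)) (\<lambda>x. \<phi> (x (fst p)) (x (snd p)))" if "p \<in> edges I" for p
    using edgesD[OF that]
    by (intro PI.integrable_bounded[where K = B] kernel_component_measurable kernel_component_bound) auto
  ultimately show ?thesis unfolding pair_sum_def by (simp add: Bochner_Integration.integral_sum)
qed

lemma pair_sum_bound:
  assumes "x \<in> space (Pi\<^sub>M I (\<lambda>_. D))"
  shows "\<bar>pair_sum I x\<bar> \<le> B * card (edges I)"
proof -
  have "\<bar>pair_sum I x\<bar> \<le> (\<Sum>p\<in>edges I. \<bar>\<phi> (x (fst p)) (x (snd p))\<bar>)"
    unfolding pair_sum_def by (rule sum_abs)
  also have "\<dots> \<le> (\<Sum>p\<in>edges I. B)"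
    using assms by (intro sum_mono kernel_component_bound) (auto dest: edgesD)
  finally show ?thesis by (simp add: mult.commute)
qed

text \<open>
  After expanding the power, a term survives integration only if no index occurs exactly once
  among its \<open>2 k\<close> endpoints.
\<close>
lemma pair_sum_moment:
  assumes fin: "finite I"
  shows "\<bar>\<integral>x. pair_sum I x ^ k \<partial>Pi\<^sub>M I (\<lambda>_. D)\<bar> \<le>
    B ^ k * card (no_singles I ({..<k} \<times> (UNIV :: bool set)))"
proof -
  interpret PI: prob_space "Pi\<^sub>M I (\<lambda>_. D)" by (rule prob_space_PiM) (rule prob_space_axioms)
  define G where "G = {..<k} \<rightarrow>\<^sub>E edges I"
  define F where "F g x = (\<Prod>l<k. \<phi> (x (fst (g l))) (x (snd (g l))))"
    for g :: "nat \<Rightarrow> 'b \<times> 'b" and x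
  \<comment> \<open>\<open>e g\<close> reads a choice of k edges as a map on 2 k endpoint slots: the
    number of the factor and a flag for its first or second argument.\<close>
  define e where "e g = restrict (\<lambda>(l, b). if b then fst (g l) else snd (g l)) ({..<k} \<times> (UNIV :: bool set))"
    for g :: "nat \<Rightarrow> 'b \<times> 'b"
  have finG: "finite G" unfolding G_def using finite_edges[OF fin] by (intro finite_PiE) auto
  have gE: "fst (g l) \<in> I" "snd (g l) \<in> I" "fst (g l) \<noteq> snd (g l)" if "g \<in> G" "l < k" for g l
    using that edgesD[of "g l" I] by (auto simp: G_def PiE_def Pi_def)
  have meas: "F g \<in> borel_measurable (Pi\<^sub>M I (\<lambda>_. D))" if "g \<in> G" for g
    unfolding F_def using that by (intro borel_measurable_prod kernel_component_measurable gE) auto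
  have bound: "\<bar>F g x\<bar> \<le> B ^ k" if "g \<in> G" "x \<in> space (Pi\<^sub>M I (\<lambda>_. D))" for g x
    unfolding F_def abs_prod
    using prod_mono[of "{..<k}" "\<lambda>l. \<bar>\<phi> (x (fst (g l))) (x (snd (g l)))\<bar>" "\<lambda>_. B"]
    by (simp add: kernel_component_bound[OF _ _ that(2)] gE[OF that(1)])
  have "pair_sum I x ^ k = (\<Sum>g\<in>G. F g x)" for x
  proof -
    have "pair_sum I x ^ k = (\<Prod>l<k. pair_sum I x)" by simp
    also have "\<dots> = (\<Sum>g\<in>G. F g x)"
      unfolding pair_sum_def F_def G_def using finite_edges[OF fin] by (subst prod_sum_PiE) auto
    finally show ?thesis .
  qed
  then have "(\<integral>x. pair_sum I x ^ k \<partial>Pi\<^sub>M I (\<lambda>_. D)) = (\<Sum>g\<in>G. \<integral>x. F g x \<partial>Pi\<^sub>M I (\<lambda>_. D))"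
    using PI.integrable_bounded[OF meas bound] by (simp add: Bochner_Integration.integral_sum)
  also have "\<bar>\<dots>\<bar> \<le> (\<Sum>g\<in>G. \<bar>\<integral>x. F g x \<partial>Pi\<^sub>M I (\<lambda>_. D)\<bar>)" by (rule sum_abs)
  also have "\<dots> \<le> (\<Sum>g\<in>G. if e g \<in> no_singles I ({..<k} \<times> UNIV) then B ^ k else 0)"
  proof (rule sum_mono)
    fix g assume g: "g \<in> G"
    show "\<bar>\<integral>x. F g x \<partial>Pi\<^sub>M I (\<lambda>_. D)\<bar> \<le> (if e g \<in> no_singles I ({..<k} \<times> UNIV) then B ^ k else 0)"
    proof (cases "e g \<in> no_singles I ({..<k} \<times> UNIV)")
      case True
      then show ?thesis using PI.abs_integral_le_const[OF meas[OF g] bound[OF g]] by simp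
    next
      case False
      moreover have "e g \<in> {..<k} \<times> UNIV \<rightarrow>\<^sub>E I" using gE[OF g] by (auto simp: e_def)
      ultimately obtain i where i: "i \<in> I" "card {m \<in> {..<k} \<times> UNIV. e g m = i} = 1"
        by (auto simp: no_singles_def)
      then obtain m0 where "{m \<in> {..<k} \<times> UNIV. e g m = i} = {m0}" by (auto simp: card_1_singleton_iff)
      then obtain l0 b0 where m0: "{m \<in> {..<k} \<times> UNIV. e g m = i} = {(l0, b0)}" by (cases m0) auto
      then have l0: "l0 < k" "e g (l0, b0) = i" by auto
      have uniq: "l = l0" if "l < k" "e g (l, b) = i" for l b
      proof -
        have "(l, b) \<in> {m \<in> {..<k} \<times> UNIV. e g m = i}" using that by auto
        then show ?thesis unfolding m0 by simp
      qed
      \<comment> \<open>The index \<open>i\<close> fills exactly one slot, so it occurs in the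
        single factor \<open>l0\<close> and the integral over its coordinate vanishes.\<close>
      have "(\<integral>x. F g x \<partial>Pi\<^sub>M I (\<lambda>_. D)) = 0"
        unfolding F_def
      proof (rule integral_edges_eq_0[OF fin _ i(1)])
        show "l0 \<in> {..<k}" using l0 by simp
        show "i = fst (g l0) \<or> i = snd (g l0)" using l0 by (cases b0) (auto simp: e_def)
        show "i \<noteq> fst (g l) \<and> i \<noteq> snd (g l)" if "l \<in> {..<k}" "l \<noteq> l0" for l
          using uniq[of l True] uniq[of l False] that by (auto simp: e_def)
      qed (use gE[OF g] in \<open>auto simp: mem_Times_iff\<close>)
      then show ?thesis using False by simp
    qed
  qed
  also have "\<dots> = B ^ k * card {g\<in>G. e g \<in> no_singles I ({..<k} \<times> UNIV)}"
    using finG by (simp add: sum.inter_filter[symmetric] mult.commute)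
  also have "\<dots> \<le> B ^ k * card (no_singles I ({..<k} \<times> (UNIV :: bool set)))"
  proof -
    \<comment> \<open>The edges can be recovered from their endpoints, so there are no more
      surviving products than maps without singleton fibres.\<close>
    have "inj_on e G"
    proof (rule inj_onI)
      fix g h assume gh: "g \<in> G" "h \<in> G" "e g = e h"
      show "g = h"
      proof (rule PiE_ext[of _ "{..<k}" "\<lambda>_. edges I"])
        fix l assume "l \<in> {..<k}"
        then show "g l = h l"
          using fun_cong[OF gh(3), of "(l, True)"] fun_cong[OF gh(3), of "(l, False)"]
          by (auto simp: e_def prod_eq_iff)
      qed (use gh in \<open>auto simp: G_def\<close>)
    qed
    then have "card {g\<in>G. e g \<in> no_singles I ({..<k} \<times> UNIV)} \<le> card (no_singles I ({..<k} \<times> (UNIV :: bool set)))"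
      using fin by (intro card_inj_on_le[of e]) (auto intro: finite_no_singles inj_on_subset)
    then show ?thesis using B_nonneg by (intro mult_left_mono) auto
  qed
  finally show ?thesis .
qed

text \<open>With the optimal radius in the counting bound, the powers k^k and e^k cancel against
  those in the estimate of (2 k)! / k!. The ratio that is left has the constant 4 * 9/10 =
  18/5.\<close>

lemma pair_sum_exp_term:
  assumes fin: "finite I" "I \<noteq> {}" and k: "k \<ge> 1"
  shows "\<bar>\<integral>x. (t * pair_sum I x) ^ k / fact k \<partial>Pi\<^sub>M I (\<lambda>_. D)\<bar> \<le>
    exp 1 * real k * (18/5 * \<bar>t\<bar> * B * card I) ^ k"
proof -
  define N where "N = real (card I)"
  define c :: real where "c = 9/10"
  have N: "N > 0" using fin by (simp add: N_def card_gt_0_iff)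
  \<comment> \<open>This choice minimises exp (c N r^2) / r^(2k). It gives c N r^2 = k, so the
    exponential becomes e^k.\<close>
  define r where "r = sqrt (real k / (c * N))"
  have r: "r > 0" "r\<^sup>2 = real k / (c * N)" using N k by (auto simp: r_def c_def)
  have r2k: "r ^ (2 * k) = (real k / (c * N)) ^ k" using r by (simp add: power_mult)
  have "exp r - r \<ge> 0" using exp_ge_add_one_self[of r] by linarith
  then have "(exp r - r) ^ card I \<le> exp (c * r\<^sup>2) ^ card I"
    using exp_minus_self_le[of r] r by (intro power_mono) (auto simp: c_def)
  also have "\<dots> = exp (real k)"
    using N r by (simp add: exp_of_nat_mult[symmetric] c_def N_def)
  finally have E: "(exp r - r) ^ card I \<le> exp (real k)" .
  have "\<bar>\<integral>x. (t * pair_sum I x) ^ k / fact k \<partial>Pi\<^sub>M I (\<lambda>_. D)\<bar> =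
      \<bar>t\<bar> ^ k / fact k * \<bar>\<integral>x. pair_sum I x ^ k \<partial>Pi\<^sub>M I (\<lambda>_. D)\<bar>"
    by (simp add: power_mult_distrib abs_mult power_abs)
  also have "\<dots> \<le> \<bar>t\<bar> ^ k / fact k * (B ^ k * (fact (2 * k) * exp (real k) / r ^ (2 * k)))"
  proof -
    have "real (card (no_singles I ({..<k} \<times> (UNIV :: bool set)))) \<le> fact (2 * k) * (exp r - r) ^ card I / r ^ (2 * k)"
      using card_no_singles_le[OF fin(1) _ r(1), of "{..<k} \<times> (UNIV :: bool set)"]
      by (simp add: card_cartesian_product mult.commute)
    also have "\<dots> \<le> fact (2 * k) * exp (real k) / r ^ (2 * k)"
      using E r by (intro divide_right_mono mult_left_mono) auto
    finally have "B ^ k * card (no_singles I ({..<k} \<times> (UNIV :: bool set))) \<le> B ^ k * (fact (2 * k) * exp (real k) / r ^ (2 * k))"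
      using B_nonneg by (intro mult_left_mono) auto
    with pair_sum_moment[OF fin(1), of k] show ?thesis
      by (intro mult_left_mono) auto
  qed
  also have "\<dots> = fact (2 * k) / fact k * ((\<bar>t\<bar> * B * c * N) ^ k * (exp 1 / real k) ^ k)"
    using N k unfolding r2k
    by (simp add: power_mult_distrib power_divide exp_of_nat_mult[symmetric] mult_ac)
  also have "\<dots> \<le> exp 1 * real k * (4 * real k / exp 1) ^ k * ((\<bar>t\<bar> * B * c * N) ^ k * (exp 1 / real k) ^ k)"
    using B_nonneg N by (intro mult_right_mono fact_double_div_fact_le k) (auto simp: c_def)
  also have "\<dots> = exp 1 * real k * ((4 * real k / exp 1) * (\<bar>t\<bar> * B * c * N) * (exp 1 / real k)) ^ k"
    by (simp only: power_mult_distrib mult.assoc)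
  also have "(4 * real k / exp 1) * (\<bar>t\<bar> * B * c * N) * (exp 1 / real k) = 18/5 * \<bar>t\<bar> * B * card I"
    using k by (simp add: c_def N_def)
  finally show ?thesis .
qed

lemma pair_sum_exp_bound:
  assumes fin: "finite I" "I \<noteq> {}"
    and q: "18/5 * \<bar>t\<bar> * B * card I \<le> q" "q < 1"
  shows "(\<integral>x. exp (t * pair_sum I x) \<partial>Pi\<^sub>M I (\<lambda>_. D)) \<le> 1 + exp 1 * (\<Sum>k. real k * q ^ k)"
proof -
  interpret PI: prob_space "Pi\<^sub>M I (\<lambda>_. D)" by (rule prob_space_PiM) (rule prob_space_axioms)
  \<comment> \<open>A crude bound that grows with the number of indices. It only justifies
    integrating the series term by term; the final estimate depends on \<open>q\<close>
    alone.\<close>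
  define K where "K = \<bar>t\<bar> * (B * card (edges I))"
  define f where "f k x = (t * pair_sum I x) ^ k / fact k" for k x
  have meas: "f k \<in> borel_measurable (Pi\<^sub>M I (\<lambda>_. D))" for k
    unfolding f_def using pair_sum_measurable by measurable
  have bound: "\<bar>f k x\<bar> \<le> K ^ k / fact k" if "x \<in> space (Pi\<^sub>M I (\<lambda>_. D))" for k x
    unfolding f_def K_def abs_divide power_abs abs_mult using pair_sum_bound[OF that]
    by (auto intro!: divide_right_mono power_mono mult_left_mono)
  have sumK: "summable (\<lambda>k. K ^ k / fact k)"
    using exp_converges[of K] by (simp add: sums_iff divide_inverse mult.commute)
  have f_exp: "f k x = (t * pair_sum I x) ^ k /\<^sub>R fact k" for k x
    by (simp add: f_def divide_inverse mult.commute)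
  have fsum: "(\<lambda>k. \<integral>x. f k x \<partial>Pi\<^sub>M I (\<lambda>_. D)) sums (\<integral>x. (\<Sum>k. f k x) \<partial>Pi\<^sub>M I (\<lambda>_. D))"
  proof (rule sums_integral)
    show "integrable (Pi\<^sub>M I (\<lambda>_. D)) (f k)" for k by (rule PI.integrable_bounded[OF meas bound])
    show "AE x in Pi\<^sub>M I (\<lambda>_. D). summable (\<lambda>k. norm (f k x))"
      using summable_norm_exp[of "t * pair_sum I _"] by (simp add: f_exp)
    show "summable (\<lambda>k. \<integral>x. norm (f k x) \<partial>Pi\<^sub>M I (\<lambda>_. D))"
    proof (rule summable_comparison_test'[OF sumK])
      fix k
      show "norm (\<integral>x. norm (f k x) \<partial>Pi\<^sub>M I (\<lambda>_. D)) \<le> K ^ k / fact k"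
        using PI.abs_integral_le_const[of "\<lambda>x. norm (f k x)" "K ^ k / fact k"] meas bound by simp
    qed
  qed
  have "18/5 * \<bar>t\<bar> * B * card I \<ge> 0" using B_nonneg by simp
  then have q0: "q \<ge> 0" using q by linarith
  have sumq: "summable (\<lambda>k. real k * q ^ k)"
  proof -
    have "summable (\<lambda>n. real (Suc n) * q ^ n * q)"
      using q0 q(2) by (intro summable_mult2 sums_summable[OF geometric_deriv_sums]) auto
    then have "summable (\<lambda>n. real (Suc n) * q ^ Suc n)" by (simp only: power_Suc2 mult.assoc)
    then show ?thesis by (simp only: summable_Suc_iff[of "\<lambda>k. real k * q ^ k"])
  qed
  \<comment> \<open>The term of order zero is exactly 1 and has to be kept apart, because the
    majorant \<open>real k * q ^ k\<close> vanishes at k = 0.\<close>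
  have le: "(\<integral>x. f k x \<partial>Pi\<^sub>M I (\<lambda>_. D)) \<le> (if k = 0 then 1 else 0) + exp 1 * (real k * q ^ k)" for k
  proof (cases "k = 0")
    case True then show ?thesis by (simp add: f_def PI.prob_space)
  next
    case False
    then have "\<bar>\<integral>x. f k x \<partial>Pi\<^sub>M I (\<lambda>_. D)\<bar> \<le> exp 1 * real k * (18/5 * \<bar>t\<bar> * B * card I) ^ k"
      unfolding f_def by (intro pair_sum_exp_term fin) auto
    also have "\<dots> \<le> exp 1 * real k * q ^ k"
      using q B_nonneg by (intro mult_left_mono power_mono) auto
    finally show ?thesis using False by (simp add: mult.assoc)
  qed
  have "(\<integral>x. exp (t * pair_sum I x) \<partial>Pi\<^sub>M I (\<lambda>_. D)) = (\<integral>x. (\<Sum>k. f k x) \<partial>Pi\<^sub>M I (\<lambda>_. D))"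
    by (simp add: exp_def f_exp)
  also have "\<dots> \<le> 1 + exp 1 * (\<Sum>k. real k * q ^ k)"
  proof (rule sums_le[OF le fsum])
    show "(\<lambda>k. (if k = 0 then 1 else 0) + exp 1 * (real k * q ^ k)) sums (1 + exp 1 * (\<Sum>k. real k * q ^ k))"
      by (intro sums_add sums_mult summable_sums[OF sumq] sums_single[of 0 "\<lambda>_. 1", simplified])
  qed
  finally show ?thesis .
qed

end

subsection \<open>Relative entropy of tilted measures\<close>

lemma ext_integral_cong_AE:
  assumes "AE x in M. f x = g x"
  shows "ext_integral M f = ext_integral M g"
proof -
  have "(\<integral>\<^sup>+ x. ennreal (f x) \<partial>M) = (\<integral>\<^sup>+ x. ennreal (g x) \<partial>M)"
    "(\<integral>\<^sup>+ x. ennreal (- f x) \<partial>M) = (\<integral>\<^sup>+ x. ennreal (- g x) \<partial>M)"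
    using assms by (auto intro!: nn_integral_cong_AE)
  then show ?thesis by (simp add: ext_integral_def)
qed

lemma ext_integral_integrable:
  assumes "integrable M f"
  shows "ext_integral M f = ereal (\<integral>x. f x \<partial>M)"
proof -
  have *: "enn2ereal x = ereal (enn2real x)" if "x \<noteq> \<infinity>" for x
    using that by (cases x) auto
  have "(\<integral>\<^sup>+ x. ennreal (f x) \<partial>M) \<noteq> \<infinity>" "(\<integral>\<^sup>+ x. ennreal (- f x) \<partial>M) \<noteq> \<infinity>"
    using assms by (auto simp: real_integrable_def)
  then show ?thesis
    unfolding ext_integral_def real_lebesgue_integral_def[OF assms] by (simp add: *)
qed

text \<open>Jensen's inequality for the exponential: integrate its tangent at the mean of
  \<open>g\<close>.\<close>

lemma (in prob_space) exp_integral_le_integral_exp: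
  fixes g :: "'a \<Rightarrow> real"
  assumes "integrable M g" "integrable M (\<lambda>x. exp (g x))"
  shows "exp (\<integral>x. g x \<partial>M) \<le> (\<integral>x. exp (g x) \<partial>M)"
proof -
  define m where "m = (\<integral>x. g x \<partial>M)"
  have "exp m = (\<integral>x. exp m * (1 + (g x - m)) \<partial>M)"
    using assms(1) by (simp add: prob_space m_def)
  also have "\<dots> \<le> (\<integral>x. exp (g x) \<partial>M)"
  proof (rule integral_mono[OF _ assms(2)])
    show "integrable M (\<lambda>x. exp m * (1 + (g x - m)))" using assms(1) by auto
    fix x
    have "exp m * (1 + (g x - m)) \<le> exp m * exp (g x - m)"
      by (intro mult_left_mono exp_ge_add_one_self) auto
    then show "exp m * (1 + (g x - m)) \<le> exp (g x)" by (simp flip: exp_add)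
  qed
  finally show ?thesis by (simp add: m_def)
qed

text \<open>
  Jensen's inequality under the tilted measure, whose density is \<open>exp g / c\<close> with \<open>c \<ge> 1\<close>,
  turns an exponential moment of order \<open>1 + \<delta>\<close> into an entropy bound.
\<close>
lemma (in prob_space) relative_entropy_tilted_le:
  fixes g :: "'a \<Rightarrow> real"
  assumes meas [measurable]: "g \<in> borel_measurable M" and bound: "\<And>x. x \<in> space M \<Longrightarrow> \<bar>g x\<bar> \<le> K"
    and zero: "(\<integral>x. g x \<partial>M) = 0"
    and moment: "(\<integral>x. exp ((1 + \<delta>) * g x) \<partial>M) \<le> L" and "\<delta> > 0"
  defines "c \<equiv> (\<integral>x. exp (g x) \<partial>M)"
  shows "relative_entropy (density M (\<lambda>x. ennreal (exp (g x) / c))) M \<le> ereal (ln L / \<delta>)"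
proof -
  have ie: "integrable M (\<lambda>x. exp (a * g x))" for a
  proof (rule integrable_bounded[where K = "exp (\<bar>a\<bar> * K)"])
    fix x assume "x \<in> space M"
    then have "\<bar>a * g x\<bar> \<le> \<bar>a\<bar> * K" using bound by (simp add: abs_mult mult_left_mono)
    then show "\<bar>exp (a * g x)\<bar> \<le> exp (\<bar>a\<bar> * K)" by simp
  qed measurable
  have ig: "integrable M g" by (rule integrable_bounded[OF meas bound])
  \<comment> \<open>Since \<open>g\<close> has mean zero, Jensen's inequality bounds the normalising
    constant from below. Its contribution - ln c to the entropy is therefore not positive.\<close>
  have c1: "c \<ge> 1"
    using exp_integral_le_integral_exp[OF ig] ie[of 1] zero by (simp add: c_def)
  define f where "f x = exp (g x) / c" for x
  have f_meas [measurable]: "f \<in> borel_measurable M" unfolding f_def by measurable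
  have f_pos: "f x > 0" for x using c1 by (simp add: f_def)
  define \<mu> where "\<mu> = density M (\<lambda>x. ennreal (f x))"
  have int_f: "(\<integral>x. f x \<partial>M) = 1" using c1 by (simp add: f_def c_def)
  interpret \<mu>: prob_space \<mu>
    unfolding \<mu>_def
  proof (rule prob_spaceI)
    have "integrable M f" using ie[of 1] by (simp add: f_def[abs_def])
    then have "(\<integral>\<^sup>+x. ennreal (f x) \<partial>M) = 1"
      using f_pos int_f by (subst nn_integral_eq_integral) (auto intro: less_imp_le)
    then show "emeasure (density M (\<lambda>x. ennreal (f x))) (space (density M (\<lambda>x. ennreal (f x)))) = 1"
      by (simp add: emeasure_density cong: nn_integral_cong)
  qed
  have sp: "space \<mu> = space M" by (simp add: \<mu>_def)
  have \<mu>_meas: "h \<in> borel_measurable \<mu> \<longleftrightarrow> h \<in> borel_measurable M" for h :: "'a \<Rightarrow> real"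
    unfolding \<mu>_def by simp
  have i\<mu>: "integrable \<mu> g" using meas bound by (intro \<mu>.integrable_bounded[where K = K]) (auto simp: \<mu>_meas sp)
  have i\<mu>e: "integrable \<mu> (\<lambda>x. exp (\<delta> * g x))"
  proof (rule \<mu>.integrable_bounded[where K = "exp (\<delta> * K)"])
    fix x assume "x \<in> space \<mu>"
    then show "\<bar>exp (\<delta> * g x)\<bar> \<le> exp (\<delta> * K)" using bound[of x] \<open>\<delta> > 0\<close> by (auto simp: sp)
  qed (simp add: \<mu>_meas)
  have "absolutely_continuous M \<mu>" unfolding \<mu>_def by (rule absolutely_continuousI_density) measurable
  moreover have "AE x in M. ennreal (f x) = RN_deriv M \<mu> x"
    by (rule RN_deriv_unique) (auto simp: \<mu>_def)
  then have "AE x in \<mu>. ln (enn2real (RN_deriv M \<mu> x)) = g x - ln c"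
    unfolding \<mu>_def using f_pos c1
    by (subst AE_density) (auto elim!: eventually_mono simp: f_def ln_div dest: sym)
  ultimately have "relative_entropy \<mu> M = ext_integral \<mu> (\<lambda>x. g x - ln c)"
    unfolding relative_entropy_def by (simp add: ext_integral_cong_AE)
  also have "\<dots> = ereal ((\<integral>x. g x \<partial>\<mu>) - ln c)"
    using i\<mu> by (subst ext_integral_integrable) (auto simp: \<mu>.prob_space)
  also have "\<dots> \<le> ereal (ln L / \<delta>)"
  proof -
    \<comment> \<open>Under the tilted measure the moment of order \<delta> acquires the factor exp
      g of the density and becomes a moment of order 1 + \<delta> under \<open>M\<close>.\<close>
    have "exp (\<delta> * (\<integral>x. g x \<partial>\<mu>)) \<le> (\<integral>x. exp (\<delta> * g x) \<partial>\<mu>)"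
      using \<mu>.exp_integral_le_integral_exp[of "\<lambda>x. \<delta> * g x"] i\<mu> i\<mu>e by simp
    also have "\<dots> = (\<integral>x. f x * exp (\<delta> * g x) \<partial>M)"
      unfolding \<mu>_def using f_pos by (subst integral_density) (auto intro: less_imp_le)
    also have "\<dots> = (\<integral>x. exp ((1 + \<delta>) * g x) \<partial>M) / c"
      by (simp add: f_def distrib_right exp_add)
    also have "\<dots> \<le> (\<integral>x. exp ((1 + \<delta>) * g x) \<partial>M)"
    proof -
      have "(\<integral>x. exp ((1 + \<delta>) * g x) \<partial>M) \<ge> 0" by (rule integral_nonneg_AE) auto
      then have "(\<integral>x. exp ((1 + \<delta>) * g x) \<partial>M) / c \<le> (\<integral>x. exp ((1 + \<delta>) * g x) \<partial>M) / 1"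
        using c1 by (intro divide_left_mono) auto
      then show ?thesis by simp
    qed
    also note moment
    finally have "exp (\<delta> * (\<integral>x. g x \<partial>\<mu>)) \<le> L" .
    then have "\<delta> * (\<integral>x. g x \<partial>\<mu>) \<le> ln L"
      by (metis exp_gt_zero less_le_trans ln_exp ln_le_cancel_iff)
    moreover have "ln c \<ge> 0" using c1 by simp
    ultimately have "(\<integral>x. g x \<partial>\<mu>) - ln c \<le> ln L / \<delta>"
      using \<open>\<delta> > 0\<close> by (simp add: pos_le_divide_eq mult.commute) (smt (verit) mult_nonneg_nonneg right_diff_distrib)
    then show ?thesis by simp
  qed
  finally show ?thesis by (simp add: \<mu>_def f_def)
qed

subsection \<open>The Euler-Lagrange equation\<close>

lemma ext_integral_completion: "ext_integral (completion M) f = ext_integral M f"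
  by (simp add: ext_integral_def nn_integral_completion)

lemma conv_borel:
  assumes [measurable]: "W \<in> borel_measurable borel" "\<sigma> \<in> borel_measurable borel"
  shows "conv W \<sigma> x = (\<integral>y. W (x - y) * \<sigma> y \<partial>lborel)"
  unfolding conv_def by (rule integral_completion) simp

lemma conv_measurable [measurable]:
  assumes [measurable]: "W \<in> borel_measurable borel" "\<sigma> \<in> borel_measurable borel"
  shows "conv W \<sigma> \<in> borel_measurable borel"
proof -
  have "conv W \<sigma> = (\<lambda>x. \<integral>y. W (x - y) * \<sigma> y \<partial>lborel)"
    by (rule ext) (rule conv_borel; measurable)
  then show ?thesis by simp
qed

lemma integrable_bounded_mult:
  fixes f h :: "'a \<Rightarrow> real"
  assumes "integrable M f" and [measurable]: "h \<in> borel_measurable M" and "\<And>x. \<bar>h x\<bar> \<le> K"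
  shows "integrable M (\<lambda>x. h x * f x)"
proof (rule Bochner_Integration.integrable_bound)
  show "integrable M (\<lambda>x. K * f x)" using assms by auto
  have "0 \<le> K" using assms(3) abs_ge_zero order_trans by blast
  then show "AE x in M. norm (h x * f x) \<le> norm (K * f x)"
    using assms(3) by (auto simp: abs_mult intro!: mult_right_mono)
qed (use assms(1) in measurable)

text \<open>The right-hand side is the tangent at \<open>u\<close> of the convex function x ln (x /
  m). At x = 0 the left-hand side is zero and the claim reads 0 \<ge> - u.\<close>

lemma mult_ln_div_ge:
  fixes x m u :: real
  assumes "x \<ge> 0" "m > 0" "u > 0"
  shows "x * ln (x / m) \<ge> x * ln (u / m) + x - u"
proof (cases "x = 0")
  case False
  with assms have x: "x > 0" by simp
  have "ln (u / x) \<le> u / x - 1" using assms x by (intro ln_le_minus_one) auto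
  then have "x * ln (u / x) \<le> x * (u / x - 1)" using x by (intro mult_left_mono) auto
  then have "x * ln (u / x) \<le> u - x" using x by (simp add: algebra_simps)
  moreover have "ln (u / x) = ln (u / m) - ln (x / m)" using assms x by (simp add: ln_div)
  ultimately show ?thesis by (simp add: algebra_simps)
qed (use assms in simp)

text \<open>All data are Borel, and symmetry and boundedness of \<open>W\<close> hold at every
  point. General data are brought into this form by changing them on null sets.\<close>

locale mean_field =
  fixes \<beta> w :: real and U W :: "real^'d \<Rightarrow> real"
  assumes beta_pos: "\<beta> > 0"
    and U_measurable [measurable]: "U \<in> borel_measurable borel"
    and W_measurable [measurable]: "W \<in> borel_measurable borel"
    and W_sym: "W (- x) = W x"
    and W_bound: "\<bar>W x\<bar> \<le> w"
    and exp_U_integrable: "integrable lborel (\<lambda>x. exp (- \<beta> * U x))"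
begin

lemma w_nonneg: "w \<ge> 0" using W_bound abs_ge_zero order_trans by blast

lemma W_diff_sym: "W (x - y) = W (y - x)" using W_sym[of "x - y"] by simp

text \<open>Borel measurability is added to \<open>prob_density\<close>, which asks only for
  Lebesgue measurability, so that convolutions and product integrands are measurable for
  \<open>lborel\<close>.\<close>

definition density_on :: "(real^'d \<Rightarrow> real) \<Rightarrow> bool" where
  "density_on \<sigma> \<longleftrightarrow> \<sigma> \<in> borel_measurable borel \<and> prob_density \<sigma>"

lemma density_onD:
  assumes "density_on \<sigma>"
  shows "\<sigma> \<in> borel_measurable borel" "\<sigma> x \<ge> 0" "integrable lborel \<sigma>" "(\<integral>x. \<sigma> x \<partial>lborel) = 1"
proof -
  show \<sigma> [measurable]: "\<sigma> \<in> borel_measurable borel" and nonneg: "\<sigma> x \<ge> 0" for x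
    using assms by (auto simp: density_on_def prob_density_def)
  have *: "(\<integral>\<^sup>+x. ennreal (\<sigma> x) \<partial>lborel) = ennreal 1"
    using assms by (simp add: density_on_def prob_density_def nn_integral_completion)
  show "integrable lborel \<sigma>" "(\<integral>x. \<sigma> x \<partial>lborel) = 1"
    using integral_eq_nn_integral[of \<sigma> lborel] nonneg *
    by (auto intro!: integrableI_nonneg simp: *)
qed

lemma density_onI:
  assumes [measurable]: "\<sigma> \<in> borel_measurable borel" and nonneg: "\<And>x. \<sigma> x \<ge> 0"
    and int: "integrable lborel \<sigma>" "(\<integral>x. \<sigma> x \<partial>lborel) = 1"
  shows "density_on \<sigma>"
proof -
  have "(\<integral>\<^sup>+x. ennreal (\<sigma> x) \<partial>lborel) = 1"
    using nn_integral_eq_integral[OF int(1)] nonneg int(2) by simp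
  then show ?thesis
    using nonneg by (simp add: density_on_def prob_density_def nn_integral_completion measurable_completion)
qed

lemma kernel_integrable: "integrable lborel \<sigma> \<Longrightarrow> integrable lborel (\<lambda>y. W (x - y) * \<sigma> y)"
  by (rule integrable_bounded_mult[where K = w]) (use W_bound in auto)

lemma conv_bound:
  assumes "density_on \<sigma>"
  shows "\<bar>conv W \<sigma> x\<bar> \<le> w"
proof -
  note \<sigma> = density_onD[OF assms] and [measurable] = density_onD(1)[OF assms]
  have "\<bar>conv W \<sigma> x\<bar> \<le> (\<integral>y. \<bar>W (x - y) * \<sigma> y\<bar> \<partial>lborel)"
    unfolding conv_borel[OF W_measurable \<sigma>(1)] by (rule integral_abs_bound)
  also have "\<dots> \<le> (\<integral>y. w * \<sigma> y \<partial>lborel)"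
    using \<sigma> W_bound
    by (intro integral_mono integrable_abs kernel_integrable) (auto simp: abs_mult intro!: mult_right_mono)
  finally show ?thesis using \<sigma> by simp
qed

section \<open>The interaction energy as a bilinear form\<close>

definition interaction :: "(real^'d \<Rightarrow> real) \<Rightarrow> (real^'d \<Rightarrow> real) \<Rightarrow> real" where
  "interaction \<sigma> \<tau> = (\<integral>x. \<sigma> x * conv W \<tau> x \<partial>lborel)"

lemma conv_mult_integrable:
  assumes "integrable lborel \<sigma>" "density_on \<tau>"
  shows "integrable lborel (\<lambda>x. \<sigma> x * conv W \<tau> x)"
proof -
  note [measurable] = density_onD(1)[OF assms(2)]
  have "integrable lborel (\<lambda>x. conv W \<tau> x * \<sigma> x)"
    by (rule integrable_bounded_mult[OF assms(1) _ conv_bound[OF assms(2)]]) measurable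
  then show ?thesis by (simp add: mult.commute)
qed

lemma interaction_bound:
  assumes "density_on \<sigma>" "density_on \<tau>"
  shows "\<bar>interaction \<sigma> \<tau>\<bar> \<le> w"
proof -
  note \<sigma> = density_onD[OF assms(1)]
  have "\<bar>interaction \<sigma> \<tau>\<bar> \<le> (\<integral>x. \<bar>\<sigma> x * conv W \<tau> x\<bar> \<partial>lborel)"
    unfolding interaction_def by (rule integral_abs_bound)
  also have "\<dots> \<le> (\<integral>x. \<sigma> x * w \<partial>lborel)"
    using \<sigma> conv_bound[OF assms(2)]
    by (intro integral_mono integrable_abs conv_mult_integrable assms(2)) (auto simp: abs_mult intro!: mult_left_mono)
  finally show ?thesis using \<sigma> by simp
qed

text \<open>Fubini's theorem, justified by the bound \<open>w\<close> on the kernel, followed by the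
  evenness of \<open>W\<close>.\<close>

lemma interaction_commute:
  assumes "density_on \<sigma>" "density_on \<tau>"
  shows "interaction \<sigma> \<tau> = interaction \<tau> \<sigma>"
proof -
  note \<sigma> = density_onD[OF assms(1)] and \<tau> = density_onD[OF assms(2)]
  note [measurable] = \<sigma>(1) \<tau>(1)
  define f where "f x y = \<sigma> x * (W (x - y) * \<tau> y)" for x y
  have i: "integrable (lborel \<Otimes>\<^sub>M lborel) (case_prod f)"
  proof (rule lborel_pair.Fubini_integrable)
    show "case_prod f \<in> borel_measurable (lborel \<Otimes>\<^sub>M lborel)" unfolding f_def by measurable
    show "AE x in lborel. integrable lborel (\<lambda>y. case_prod f (x, y))"
      using kernel_integrable[OF \<tau>(3)] by (auto simp: f_def)
    have "integrable lborel (\<lambda>x. (\<integral>y. \<bar>W (x - y)\<bar> * \<tau> y \<partial>lborel) * \<sigma> x)"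
    proof (rule integrable_bounded_mult[OF \<sigma>(3), where K = w])
      fix x
      have "(\<integral>y. \<bar>W (x - y)\<bar> * \<tau> y \<partial>lborel) \<le> (\<integral>y. w * \<tau> y \<partial>lborel)"
        using \<tau> W_bound w_nonneg
        by (intro integral_mono_AE' always_eventually allI mult_right_mono) auto
      moreover have "(\<integral>y. \<bar>W (x - y)\<bar> * \<tau> y \<partial>lborel) \<ge> 0"
        using \<tau>(2) by (intro integral_nonneg_AE) auto
      ultimately show "\<bar>\<integral>y. \<bar>W (x - y)\<bar> * \<tau> y \<partial>lborel\<bar> \<le> w" using \<tau> by simp
    qed measurable
    then show "integrable lborel (\<lambda>x. \<integral>y. norm (case_prod f (x, y)) \<partial>lborel)"
      using \<sigma>(2) \<tau>(2) by (simp add: f_def abs_mult mult.commute)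
  qed
  have "interaction \<sigma> \<tau> = (\<integral>x. (\<integral>y. f x y \<partial>lborel) \<partial>lborel)"
    by (simp add: interaction_def conv_borel f_def)
  also have "\<dots> = (\<integral>y. (\<integral>x. f x y \<partial>lborel) \<partial>lborel)"
    using lborel_pair.Fubini_integral[OF i] by simp
  also have "\<dots> = (\<integral>y. \<tau> y * (\<integral>x. W (y - x) * \<sigma> x \<partial>lborel) \<partial>lborel)"
  proof (rule Bochner_Integration.integral_cong[OF refl])
    fix y
    have "(\<integral>x. f x y \<partial>lborel) = (\<integral>x. \<tau> y * (W (y - x) * \<sigma> x) \<partial>lborel)"
      by (intro Bochner_Integration.integral_cong) (auto simp: f_def W_diff_sym[of _ y])
    then show "(\<integral>x. f x y \<partial>lborel) = \<tau> y * (\<integral>x. W (y - x) * \<sigma> x \<partial>lborel)" by simp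
  qed
  also have "\<dots> = interaction \<tau> \<sigma>" by (simp add: interaction_def conv_borel)
  finally show ?thesis .
qed

lemma interaction_add_left:
  assumes "density_on \<sigma>" "density_on \<sigma>'" "density_on \<tau>"
  shows "interaction (\<lambda>x. a * \<sigma> x + b * \<sigma>' x) \<tau> = a * interaction \<sigma> \<tau> + b * interaction \<sigma>' \<tau>"
  using conv_mult_integrable[OF _ assms(3)] density_onD(3)[OF assms(1)] density_onD(3)[OF assms(2)]
  by (simp add: interaction_def distrib_right mult.assoc)

definition entropy_density :: "(real^'d \<Rightarrow> real) \<Rightarrow> (real^'d \<Rightarrow> real) \<Rightarrow> real^'d \<Rightarrow> real" where
  "entropy_density m \<sigma> x = \<sigma> x * ln (\<sigma> x / m x)"

definition free_energy_density :: "(real^'d \<Rightarrow> real) \<Rightarrow> real^'d \<Rightarrow> real" where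
  "free_energy_density \<sigma> x = U x * \<sigma> x + 1 / \<beta> * (\<sigma> x * ln (\<sigma> x))"

lemma free_energy_borel:
  assumes "density_on \<sigma>"
  shows "free_energy \<beta> U W \<sigma> = ext_integral lborel (free_energy_density \<sigma>) + ereal (1 / 2 * interaction \<sigma> \<sigma>)"
proof -
  note [measurable] = density_onD(1)[OF assms]
  have "(\<integral>x. \<sigma> x * conv W \<sigma> x \<partial>lebesgue) = interaction \<sigma> \<sigma>"
    unfolding interaction_def by (rule integral_completion) simp
  then show ?thesis
    by (simp add: free_energy_def ext_integral_completion free_energy_density_def[abs_def])
qed

section \<open>The Gibbs density of the effective potential and its fixed points\<close>

definition tilted_partition :: "(real^'d \<Rightarrow> real) \<Rightarrow> real" where
  "tilted_partition \<rho> = (\<integral>x. exp (- \<beta> * (U x + conv W \<rho> x)) \<partial>lborel)"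

text \<open>The Gibbs density for the potential U plus the convolution of W with \<rho>. The
  Euler-Lagrange equation of the free energy says that \<rho> is a fixed point of this map.\<close>

definition tilted_density :: "(real^'d \<Rightarrow> real) \<Rightarrow> real^'d \<Rightarrow> real" where
  "tilted_density \<rho> x = exp (- \<beta> * (U x + conv W \<rho> x)) / tilted_partition \<rho>"

context
  fixes \<rho> assumes \<rho>: "density_on \<rho>"
begin

lemma tilted_integrable: "integrable lborel (\<lambda>x. exp (- \<beta> * (U x + conv W \<rho> x)))"
proof -
  note [measurable] = density_onD(1)[OF \<rho>]
  have "\<bar>exp (- \<beta> * conv W \<rho> x)\<bar> \<le> exp (\<beta> * w)" for x
  proof -
    have "- conv W \<rho> x \<le> w" using conv_bound[OF \<rho>, of x] by linarith
    then show ?thesis using beta_pos mult_left_mono[of "- conv W \<rho> x" w \<beta>] by simp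
  qed
  then have "integrable lborel (\<lambda>x. exp (- \<beta> * conv W \<rho> x) * exp (- \<beta> * U x))"
    by (intro integrable_bounded_mult[OF exp_U_integrable]) auto
  then show ?thesis by (simp add: exp_add[symmetric] algebra_simps)
qed

lemma tilted_partition_pos: "tilted_partition \<rho> > 0"
proof -
  have "tilted_partition \<rho> \<ge> 0" unfolding tilted_partition_def by (intro integral_nonneg_AE) auto
  moreover have "tilted_partition \<rho> \<noteq> 0"
  proof
    assume "tilted_partition \<rho> = 0"
    then have "AE x in lborel. exp (- \<beta> * (U x + conv W \<rho> x)) = 0"
      unfolding tilted_partition_def
      by (subst (asm) integral_nonneg_eq_0_iff_AE[OF tilted_integrable]) auto
    then have "AE x in (lborel :: (real^'d) measure). False" by eventually_elim simp
    then show False by (simp add: eventually_False ae_filter_eq_bot_iff)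
  qed
  ultimately show ?thesis by linarith
qed

lemma tilted_density_pos: "tilted_density \<rho> x > 0"
  using tilted_partition_pos by (simp add: tilted_density_def)

lemma tilted_density_on: "density_on (tilted_density \<rho>)"
proof (rule density_onI)
  note [measurable] = density_onD(1)[OF \<rho>]
  show "tilted_density \<rho> \<in> borel_measurable borel" unfolding tilted_density_def by measurable
  show "integrable lborel (tilted_density \<rho>)"
    using tilted_integrable unfolding tilted_density_def[abs_def] by simp
  show "(\<integral>x. tilted_density \<rho> x \<partial>lborel) = 1"
    using tilted_partition_pos unfolding tilted_density_def by (simp add: tilted_partition_def)
qed (use tilted_density_pos less_imp_le in blast)

text \<open>Expanding the logarithm of the tilted density absorbs the possibly unbounded
  \<open>U\<close> into a relative entropy. Only a bounded multiple of \<sigma> remains.\<close>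

lemma free_energy_density_eq:
  assumes "\<sigma> x \<ge> 0"
  shows "free_energy_density \<sigma> x =
    (entropy_density (tilted_density \<rho>) \<sigma> x - (\<beta> * conv W \<rho> x + ln (tilted_partition \<rho>)) * \<sigma> x) / \<beta>"
proof (cases "\<sigma> x = 0")
  case False
  then have "ln (\<sigma> x / tilted_density \<rho> x) = ln (\<sigma> x) + \<beta> * (U x + conv W \<rho> x) + ln (tilted_partition \<rho>)"
    using assms tilted_density_pos[of x] tilted_partition_pos
    by (subst ln_div) (auto simp: tilted_density_def ln_div)
  then show ?thesis
    using beta_pos by (simp add: free_energy_density_def entropy_density_def field_simps)
qed (simp add: free_energy_density_def entropy_density_def)

lemma drift_integrable:
  assumes "density_on \<sigma>"
  shows "integrable lborel (\<lambda>x. (\<beta> * conv W \<rho> x + ln (tilted_partition \<rho>)) * \<sigma> x)"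
  using conv_mult_integrable[OF density_onD(3)[OF assms] \<rho>] density_onD(3)[OF assms]
  by (simp add: distrib_right mult.assoc mult.commute[of "conv W \<rho> _"])

text \<open>Up to a constant and the factor 1 / \<beta>, the free energy is the relative entropy
  with respect to the tilted density plus bounded interaction terms. The mixed term is subtracted
  because the reference density already contains the mean field of \<rho>.\<close>

lemma free_energy_eq:
  assumes \<sigma>: "density_on \<sigma>" and i: "integrable lborel (entropy_density (tilted_density \<rho>) \<sigma>)"
  shows "free_energy \<beta> U W \<sigma> = ereal (((\<integral>x. entropy_density (tilted_density \<rho>) \<sigma> x \<partial>lborel)
     - ln (tilted_partition \<rho>)) / \<beta> - interaction \<sigma> \<rho> + 1 / 2 * interaction \<sigma> \<sigma>)"
proof -
  have eq: "free_energy_density \<sigma> x = (entropy_density (tilted_density \<rho>) \<sigma> x -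
      (\<beta> * conv W \<rho> x + ln (tilted_partition \<rho>)) * \<sigma> x) / \<beta>" for x
    using free_energy_density_eq density_onD(2)[OF \<sigma>] by blast
  have "integrable lborel (free_energy_density \<sigma>)"
    unfolding eq[abs_def] using i drift_integrable[OF \<sigma>] by auto
  then have "ext_integral lborel (free_energy_density \<sigma>) = ereal (\<integral>x. free_energy_density \<sigma> x \<partial>lborel)"
    by (rule ext_integral_integrable)
  also have "(\<integral>x. free_energy_density \<sigma> x \<partial>lborel) = ((\<integral>x. entropy_density (tilted_density \<rho>) \<sigma> x \<partial>lborel)
      - (\<integral>x. (\<beta> * conv W \<rho> x + ln (tilted_partition \<rho>)) * \<sigma> x \<partial>lborel)) / \<beta>"
    unfolding eq using i drift_integrable[OF \<sigma>] by simp
  also have "(\<integral>x. (\<beta> * conv W \<rho> x + ln (tilted_partition \<rho>)) * \<sigma> x \<partial>lborel)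
      = \<beta> * interaction \<sigma> \<rho> + ln (tilted_partition \<rho>)"
    using conv_mult_integrable[OF density_onD(3)[OF \<sigma>] \<rho>] density_onD[OF \<sigma>]
    by (simp add: distrib_right mult.assoc mult.commute[of "conv W \<rho> _"] interaction_def)
  finally show ?thesis
    using beta_pos by (simp add: free_energy_borel[OF \<sigma>] diff_divide_distrib add_divide_distrib)
qed

lemma entropy_density_ge:
  assumes "\<sigma> x \<ge> 0"
  shows "entropy_density (tilted_density \<rho>) \<sigma> x \<ge> \<sigma> x - tilted_density \<rho> x"
  using mult_ln_div_ge[OF assms tilted_density_pos tilted_density_pos, of x x] tilted_density_pos[of x]
  by (simp add: entropy_density_def)

text \<open>The negative part is controlled by the tangent bound of
  \<open>entropy_density_ge\<close>, the positive part by finiteness of the free energy.\<close>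

lemma entropy_density_integrable:
  assumes fin: "free_energy \<beta> U W \<rho> < \<infinity>"
  shows "integrable lborel (entropy_density (tilted_density \<rho>) \<rho>)"
proof -
  note [measurable] = density_onD(1)[OF \<rho>]
  let ?f = "free_energy_density \<rho>" and ?m = "tilted_density \<rho>"
  let ?e = "entropy_density ?m \<rho>"
  let ?d = "\<lambda>x. (\<beta> * conv W \<rho> x + ln (tilted_partition \<rho>)) * \<rho> x"
  have f [measurable]: "?f \<in> borel_measurable lborel" unfolding free_energy_density_def by measurable
  have eq: "?f x = (?e x - ?d x) / \<beta>" for x
    using free_energy_density_eq density_onD(2)[OF \<rho>] by blast
  have "(\<integral>\<^sup>+x. ennreal (- ?f x) \<partial>lborel) \<noteq> \<infinity>"
  proof -
    have i: "integrable lborel (\<lambda>x. (?m x - \<rho> x + ?d x) / \<beta>)"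
      using density_onD(3)[OF \<rho>] density_onD(3)[OF tilted_density_on] drift_integrable[OF \<rho>] by auto
    have "(\<integral>\<^sup>+x. ennreal (- ?f x) \<partial>lborel) \<le> (\<integral>\<^sup>+x. ennreal ((?m x - \<rho> x + ?d x) / \<beta>) \<partial>lborel)"
    proof (intro nn_integral_mono ennreal_leI)
      fix x
      have "- ?f x = (- ?e x + ?d x) / \<beta>" unfolding eq by (simp add: minus_divide_left)
      also have "\<dots> \<le> (?m x - \<rho> x + ?d x) / \<beta>"
        using entropy_density_ge[of \<rho> x] density_onD(2)[OF \<rho>, of x] beta_pos
        by (intro divide_right_mono) auto
      finally show "- ?f x \<le> (?m x - \<rho> x + ?d x) / \<beta>" .
    qed
    also have "\<dots> < \<infinity>" using i by (auto simp: real_integrable_def less_top)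
    finally show ?thesis by simp
  qed
  moreover have "(\<integral>\<^sup>+x. ennreal (?f x) \<partial>lborel) \<noteq> \<infinity>"
  proof
    assume "(\<integral>\<^sup>+x. ennreal (?f x) \<partial>lborel) = \<infinity>"
    \<comment> \<open>In \<open>ereal\<close>, infinity minus any nonnegative value is
      infinity.\<close>
    then have "ext_integral lborel ?f = \<infinity>" by (simp add: ext_integral_def)
    then show False using fin by (simp add: free_energy_borel[OF \<rho>])
  qed
  ultimately have "integrable lborel ?f" by (simp add: real_integrable_def)
  then have "integrable lborel (\<lambda>x. \<beta> * ?f x + ?d x)" using drift_integrable[OF \<rho>] by auto
  then show ?thesis using beta_pos by (simp add: eq)
qed

text \<open>Average the tangent at the intermediate value \<open>u\<close> over the two end points;
  the integrand vanishes at the tilted density itself. The condition s > 0 keeps \<open>u\<close>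
  positive even where \<rho> is zero.\<close>

lemma entropy_density_convex:
  assumes x: "\<rho> x \<ge> 0" and s: "0 < s" "s \<le> 1"
  shows "entropy_density (tilted_density \<rho>) (\<lambda>x. (1 - s) * \<rho> x + s * tilted_density \<rho> x) x
    \<le> (1 - s) * entropy_density (tilted_density \<rho>) \<rho> x"
proof -
  define m where "m = tilted_density \<rho> x"
  define u where "u = (1 - s) * \<rho> x + s * m"
  have m: "m > 0" unfolding m_def by (rule tilted_density_pos)
  have u: "u > 0" unfolding u_def using m x s by (intro add_nonneg_pos mult_pos_pos) auto
  have "(1 - s) * (\<rho> x * ln (\<rho> x / m)) \<ge> (1 - s) * (\<rho> x * ln (u / m) + \<rho> x - u)"
    using s by (intro mult_left_mono mult_ln_div_ge x m u) auto
  moreover have "s * (m * ln (m / m)) \<ge> s * (m * ln (u / m) + m - u)"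
    using s m by (intro mult_left_mono mult_ln_div_ge u) auto
  moreover have "(1 - s) * (\<rho> x * ln (u / m) + \<rho> x - u) + s * (m * ln (u / m) + m - u) = u * ln (u / m)"
    by (simp add: u_def algebra_simps)
  ultimately show ?thesis using m by (simp add: entropy_density_def u_def m_def)
qed

text \<open>
  Compare \<open>\<rho>\<close> with \<open>(1 - s) \<rho> + s m\<close>, where \<open>m\<close> is the tilted density: the interaction changes the
  free energy by \<open>O(s\<^sup>2)\<close>, while convexity lets the relative entropy with respect to \<open>m\<close> drop by
  \<open>s\<close> times its value at \<open>\<rho>\<close>, which must therefore vanish.
\<close>
lemma minimizer_eq_tilted_density:
  assumes min: "\<And>\<sigma>. density_on \<sigma> \<Longrightarrow> free_energy \<beta> U W \<rho> \<le> free_energy \<beta> U W \<sigma>"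
  shows "AE x in lborel. \<rho> x = tilted_density \<rho> x"
proof -
  let ?m = "tilted_density \<rho>"
  let ?e = "entropy_density ?m"
  note \<rho>D = density_onD[OF \<rho>] and mD = density_onD[OF tilted_density_on]
  note [measurable] = \<rho>D(1) mD(1)
  define H where "H \<sigma> = (\<integral>x. ?e \<sigma> x \<partial>lborel)" for \<sigma>
  have "?e ?m = (\<lambda>_. 0)" using tilted_density_pos by (auto simp: entropy_density_def fun_eq_iff less_imp_neq)
  \<comment> \<open>The tilted density is a competitor of finite free energy, so the minimizer has
    finite free energy too.\<close>
  then have "free_energy \<beta> U W ?m < \<infinity>" by (subst free_energy_eq[OF tilted_density_on]) auto
  then have i\<rho>: "integrable lborel (?e \<rho>)"
    using min[OF tilted_density_on] by (intro entropy_density_integrable) auto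
  have H_le: "H \<rho> \<le> 2 * \<beta> * w * s" if s: "0 < s" "s \<le> 1" for s
  proof -
    define \<sigma> where "\<sigma> x = (1 - s) * \<rho> x + s * ?m x" for x
    have \<sigma>: "density_on \<sigma>"
      unfolding \<sigma>_def using s \<rho>D mD by (intro density_onI) auto
    have e_le: "?e \<sigma> x \<le> (1 - s) * ?e \<rho> x" for x
      unfolding \<sigma>_def using entropy_density_convex \<rho>D(2) s by blast
    have e_ge: "?e \<sigma> x \<ge> \<sigma> x - ?m x" for x
      using entropy_density_ge density_onD(2)[OF \<sigma>] by blast
    have i\<sigma>: "integrable lborel (?e \<sigma>)"
    proof (rule Bochner_Integration.integrable_bound)
      show "integrable lborel (\<lambda>x. \<bar>(1 - s) * ?e \<rho> x\<bar> + \<bar>\<sigma> x - ?m x\<bar>)"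
        using i\<rho> mD(3) density_onD(3)[OF \<sigma>] by auto
      show "?e \<sigma> \<in> borel_measurable lborel"
        using density_onD(1)[OF \<sigma>] unfolding entropy_density_def by measurable
      show "AE x in lborel. norm (?e \<sigma> x) \<le> norm (\<bar>(1 - s) * ?e \<rho> x\<bar> + \<bar>\<sigma> x - ?m x\<bar>)"
        using e_le e_ge by (intro AE_I2) (smt (verit) real_norm_def)
    qed
    have "H \<sigma> \<le> (1 - s) * H \<rho>"
      unfolding H_def using integral_mono[OF i\<sigma> _ e_le] i\<rho> by simp
    then have Hs: "(H \<sigma> - H \<rho>) / \<beta> \<le> - s * H \<rho> / \<beta>"
      using beta_pos by (intro divide_right_mono) (auto simp: algebra_simps)
    define a b c where "a = interaction \<rho> \<rho>" and "b = interaction ?m \<rho>" and "c = interaction ?m ?m"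
    have \<sigma>\<rho>: "interaction \<sigma> \<rho> = (1 - s) * a + s * b"
      unfolding \<sigma>_def a_def b_def by (rule interaction_add_left[OF \<rho> tilted_density_on \<rho>])
    have "interaction \<sigma> ?m = (1 - s) * b + s * c"
      unfolding \<sigma>_def b_def c_def interaction_commute[OF tilted_density_on \<rho>]
      by (rule interaction_add_left[OF \<rho> tilted_density_on tilted_density_on])
    moreover have "interaction \<sigma> \<sigma> = (1 - s) * interaction \<rho> \<sigma> + s * interaction ?m \<sigma>"
      using interaction_add_left[OF \<rho> tilted_density_on \<sigma>, of "1 - s" s] by (simp add: \<sigma>_def[abs_def])
    ultimately have \<sigma>\<sigma>: "interaction \<sigma> \<sigma> = (1 - s) * ((1 - s) * a + s * b) + s * ((1 - s) * b + s * c)"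
      using \<sigma>\<rho> interaction_commute[OF \<rho> \<sigma>] interaction_commute[OF tilted_density_on \<sigma>] by simp
    have "ereal ((H \<rho> - ln (tilted_partition \<rho>)) / \<beta> - a + 1 / 2 * a) \<le>
        ereal ((H \<sigma> - ln (tilted_partition \<rho>)) / \<beta> - interaction \<sigma> \<rho> + 1 / 2 * interaction \<sigma> \<sigma>)"
      using min[OF \<sigma>] unfolding free_energy_eq[OF \<rho> i\<rho>] free_energy_eq[OF \<sigma> i\<sigma>] H_def a_def .
    then have "0 \<le> (H \<sigma> - H \<rho>) / \<beta> + (a - interaction \<sigma> \<rho> + 1 / 2 * interaction \<sigma> \<sigma> - 1 / 2 * a)"
      by (simp add: diff_divide_distrib)
    \<comment> \<open>The terms of first order in s cancel, because the convolution in the tilted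
      density is the first variation of the interaction energy. With \<open>a\<close>,
      \<open>b\<close>, \<open>c\<close> bounded by \<open>w\<close>, the rest is at most 2 w
      s^2.\<close>
    also have "a - interaction \<sigma> \<rho> + 1 / 2 * interaction \<sigma> \<sigma> - 1 / 2 * a = 1 / 2 * (s * s) * (a - 2 * b + c)"
      unfolding \<sigma>\<rho> \<sigma>\<sigma> by (simp add: algebra_simps)
    also have "\<dots> \<le> 1 / 2 * (s * s) * (4 * w)"
      using interaction_bound[OF \<rho> \<rho>] interaction_bound[OF tilted_density_on \<rho>]
        interaction_bound[OF tilted_density_on tilted_density_on]
      by (intro mult_left_mono) (auto simp: a_def b_def c_def)
    finally have "s * H \<rho> / \<beta> \<le> s * (2 * s * w)" using Hs by simp
    then have "s * H \<rho> \<le> s * (2 * \<beta> * w * s)" using beta_pos by (simp add: field_simps)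
    then show ?thesis using s by simp
  qed
  have "H \<rho> \<le> 0"
  proof (rule field_le_epsilon)
    fix e :: real assume e: "e > 0"
    define s where "s = min 1 (e / (2 * \<beta> * w + 1))"
    have p: "2 * \<beta> * w + 1 > 0" using beta_pos w_nonneg by (intro add_nonneg_pos) auto
    have s: "0 < s" "s \<le> 1" using e p by (auto simp: s_def)
    have "2 * \<beta> * w * s \<le> (2 * \<beta> * w + 1) * s" using s by (simp add: distrib_right)
    also have "\<dots> \<le> (2 * \<beta> * w + 1) * (e / (2 * \<beta> * w + 1))"
      using p by (intro mult_left_mono) (auto simp: s_def)
    also have "\<dots> = e" using p by simp
    finally show "H \<rho> \<le> 0 + e" using H_le[OF s] by simp
  qed
  \<comment> \<open>Both densities have mass one, so adding their difference keeps the integral and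
    makes the integrand nonnegative.\<close>
  define h where "h x = ?e \<rho> x - \<rho> x + ?m x" for x
  have h0: "h x \<ge> 0" for x using entropy_density_ge[of \<rho> x] \<rho>D(2)[of x] by (simp add: h_def)
  have ih: "integrable lborel h" unfolding h_def using i\<rho> \<rho>D mD by auto
  have "(\<integral>x. h x \<partial>lborel) = H \<rho>" unfolding h_def H_def using i\<rho> \<rho>D mD by simp
  moreover have "(\<integral>x. h x \<partial>lborel) \<ge> 0" using h0 by (intro integral_nonneg_AE) auto
  ultimately have "(\<integral>x. h x \<partial>lborel) = 0" using \<open>H \<rho> \<le> 0\<close> by linarith
  then have "AE x in lborel. h x = 0"
    using integral_nonneg_eq_0_iff_AE[OF ih] h0 by auto
  then show ?thesis
  proof eventually_elim
    fix x assume hx: "h x = 0"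
    have m: "?m x > 0" by (rule tilted_density_pos)
    show "\<rho> x = ?m x"
    proof (cases "\<rho> x = 0")
      case True
      then show ?thesis using hx m by (simp add: h_def entropy_density_def)
    next
      case False
      then have r: "\<rho> x > 0" using \<rho>D(2)[of x] by linarith
      \<comment> \<open>This is the equality case of ln z \<le> z - 1, which forces z = 1.\<close>
      then have "\<rho> x * ln (?m x / \<rho> x) = \<rho> x * (?m x / \<rho> x - 1)"
        using hx m by (simp add: h_def entropy_density_def ln_div algebra_simps)
      then have "ln (?m x / \<rho> x) = ?m x / \<rho> x - 1" using r by simp
      then have "?m x / \<rho> x = 1" using m r by (intro ln_eq_minus_one) auto
      then show ?thesis using r by simp
    qed
  qed
qed

end

end

subsection \<open>Passage to Borel representatives\<close>

text \<open>A nonsingular affine map scales Lebesgue measure by a constant, so preimages of null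
  sets are null.\<close>

lemma AE_lborel_affine:
  fixes t :: "'a::euclidean_space"
  assumes "AE z in lborel. P z" "c \<noteq> 0"
  shows "AE y in lborel. P (t + c *\<^sub>R y)"
proof -
  have "AE z in density (distr lborel borel (\<lambda>y. t + c *\<^sub>R y)) (\<lambda>_. \<bar>c\<bar> ^ DIM('a)). P z"
    by (subst lborel_affine[OF assms(2), symmetric]) (rule assms(1))
  then have "AE z in distr lborel borel (\<lambda>y. t + c *\<^sub>R y). P z"
    using assms(2) by (subst (asm) AE_density) auto
  then show ?thesis by (rule AE_distrD[rotated]) simp
qed

lemma (in product_sigma_finite) AE_PiM_component_finite:
  assumes "finite I" "i \<in> I" "AE y in M i. P y"
  shows "AE x in Pi\<^sub>M I M. P (x i)"
proof -
  obtain N where N: "N \<in> null_sets (M i)" "{y \<in> space (M i). \<not> P y} \<subseteq> N"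
    using assms(3) by (auto simp: eventually_ae_filter)
  define A where "A = Pi\<^sub>E I (\<lambda>j. if j = i then N else space (M j))"
  have "emeasure (Pi\<^sub>M I M) A = (\<Prod>j\<in>I. emeasure (M j) (if j = i then N else space (M j)))"
    unfolding A_def using N by (intro emeasure_PiM assms(1)) auto
  \<comment> \<open>The other sides of the box may have infinite measure; a single zero factor still
    makes the product zero in \<open>ennreal\<close>.\<close>
  also have "\<dots> = 0" using assms N by (intro prod_zero) (auto intro!: bexI[of _ i])
  finally have "A \<in> null_sets (Pi\<^sub>M I M)"
    using N assms(1) unfolding A_def by (intro null_setsI sets_PiM_I_finite) auto
  moreover have "{x \<in> space (Pi\<^sub>M I M). \<not> P (x i)} \<subseteq> A"
    using N assms(2) by (auto simp: space_PiM A_def PiE_def Pi_def)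
  ultimately show ?thesis by (rule AE_I')
qed

text \<open>With all coordinates except the one at \<open>i\<close> fixed, the exceptional set is a
  translate of a null set; Fubini's theorem concludes.\<close>

lemma AE_PiM_lborel_diff:
  fixes P :: "'a::euclidean_space \<Rightarrow> bool"
  assumes "finite I" "i \<in> I" "j \<in> I" "i \<noteq> (j :: 'b)" "AE z in lborel. P z"
  shows "AE x in Pi\<^sub>M I (\<lambda>_. lborel). P (x i - x j)"
proof -
  interpret product_sigma_finite "\<lambda>_::'b. lborel :: 'a measure" by standard
  obtain N where N: "N \<in> null_sets lborel" "{z. \<not> P z} \<subseteq> N"
    using assms(5) by (auto simp: eventually_ae_filter)
  then have [measurable]: "N \<in> sets borel" by auto
  define J where "J = I - {i}"
  have J: "I = insert i J" "i \<notin> J" "finite J" "j \<in> J" using assms by (auto simp: J_def)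
  let ?P = "Pi\<^sub>M I (\<lambda>_. lborel :: 'a measure)"
  have [measurable]: "(\<lambda>x. x i - x j) \<in> borel_measurable ?P" using assms by measurable
  have "(\<integral>\<^sup>+x. indicator N (x i - x j) \<partial>?P) =
      (\<integral>\<^sup>+x. (\<integral>\<^sup>+y. indicator N ((x(i := y)) i - (x(i := y)) j) \<partial>lborel) \<partial>Pi\<^sub>M J (\<lambda>_. lborel))"
    unfolding J(1)
  proof (rule product_nn_integral_insert)
    show "(\<lambda>x. indicator N (x i - x j)) \<in> borel_measurable (Pi\<^sub>M (insert i J) (\<lambda>_. lborel :: 'a measure))"
      unfolding J(1)[symmetric] by measurable
  qed (use J in auto)
  also have "\<dots> = (\<integral>\<^sup>+x. 0 \<partial>Pi\<^sub>M J (\<lambda>_. lborel :: 'a measure))"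
  proof (rule nn_integral_cong)
    fix x :: "'b \<Rightarrow> 'a"
    have "AE y in lborel. - x j + 1 *\<^sub>R y \<notin> N"
      using AE_not_in[OF N(1)] by (rule AE_lborel_affine) simp
    then have "(\<integral>\<^sup>+y. indicator N (y - x j) \<partial>lborel) = (\<integral>\<^sup>+y. 0 \<partial>(lborel :: 'a measure))"
      by (intro nn_integral_cong_AE) (auto elim!: eventually_mono simp: indicator_def)
    then show "(\<integral>\<^sup>+y. indicator N ((x(i := y)) i - (x(i := y)) j) \<partial>lborel) = 0"
      using assms(4) by simp
  qed
  finally have "(\<integral>\<^sup>+x. indicator N (x i - x j) \<partial>?P) = 0" by simp
  then have "AE x in ?P. indicator N (x i - x j) = (0 :: ennreal)"
    by (subst (asm) nn_integral_0_iff_AE) auto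
  then show ?thesis using N(2) by (auto elim!: eventually_mono simp: indicator_def split: if_splits)
qed

section \<open>Invariance of the measures and functionals under changes on null sets\<close>

lemma density_cong_AE:
  assumes "AE x in M. f x = g x"
  shows "density M f = density M g"
proof -
  have "(\<integral>\<^sup>+x. f x * indicator A x \<partial>M) = (\<integral>\<^sup>+x. g x * indicator A x \<partial>M)" for A
    using assms by (intro nn_integral_cong_AE) (auto elim!: eventually_mono)
  then show ?thesis by (simp add: density_def)
qed

lemma tensor_measure_cong:
  assumes "AE y in lborel. \<rho> y = \<rho>' y"
  shows "tensor_measure \<rho> N = tensor_measure \<rho>' N"
proof -
  interpret product_sigma_finite "\<lambda>_::nat. lborel :: (real^'a) measure" by standard
  have "AE x in Pi\<^sub>M {..<N} (\<lambda>_. lborel). \<forall>i\<in>{..<N}. \<rho> (x i) = \<rho>' (x i)"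
    using AE_PiM_component_finite[OF _ _ assms] by (intro AE_finite_allI) auto
  then have "AE x in lebesgue_pow N. ennreal (\<Prod>i<N. \<rho> (x i)) = ennreal (\<Prod>i<N. \<rho>' (x i))"
    unfolding lebesgue_pow_def by (intro AE_completion) (auto elim!: eventually_mono)
  then show ?thesis unfolding tensor_measure_def by (rule density_cong_AE)
qed

lemma energy_cong_AE:
  assumes "AE y in lborel. U y = U' y" "AE y in lborel. W y = W' y"
  shows "AE x in Pi\<^sub>M {..<N} (\<lambda>_. lborel). energy U W N x = energy U' W' N x"
proof -
  interpret product_sigma_finite "\<lambda>_::nat. lborel :: (real^'a) measure" by standard
  have "AE x in Pi\<^sub>M {..<N} (\<lambda>_. lborel). \<forall>i\<in>{..<N}. U (x i) = U' (x i)"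
    using AE_PiM_component_finite[OF _ _ assms(1)] by (intro AE_finite_allI) auto
  moreover have "AE x in Pi\<^sub>M {..<N} (\<lambda>_. lborel). \<forall>i\<in>{..<N}. \<forall>j\<in>{..<N} - {i}. W (x i - x j) = W' (x i - x j)"
    by (intro AE_finite_allI AE_PiM_lborel_diff[OF _ _ _ _ assms(2)]) auto
  ultimately show ?thesis
  proof eventually_elim
    case (elim x)
    then have "(\<Sum>i<N. U (x i)) = (\<Sum>i<N. U' (x i))"
      "(\<Sum>i<N. \<Sum>j\<in>{..<N} - {i}. W (x i - x j)) = (\<Sum>i<N. \<Sum>j\<in>{..<N} - {i}. W' (x i - x j))"
      by (auto intro!: sum.cong)
    then show ?case by (simp add: energy_def)
  qed
qed

lemma borel_measurable_completion_cong_AE: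
  fixes f :: "'a \<Rightarrow> real"
  assumes f: "f \<in> borel_measurable (completion M)" and eq: "AE x in M. f x = g x"
  shows "g \<in> borel_measurable (completion M)"
proof (rule measurableI)
  fix A :: "real set" assume "A \<in> sets borel"
  then have A: "f -` A \<inter> space (completion M) \<in> sets (completion M)" using f by (rule measurable_sets[rotated])
  have "AE x in completion M. x \<in> f -` A \<inter> space (completion M) \<longleftrightarrow> x \<in> g -` A \<inter> space (completion M)"
    using AE_completion[OF eq] by eventually_elim auto
  then show "g -` A \<inter> space (completion M) \<in> sets (completion M)"
    using A by (rule completion.in_sets_AE) simp
qed simp

text \<open>Only the representative \<open>g\<close> has to be measurable on \<open>M\<close>;
  completeness passes this on to \<open>f\<close>.\<close>

lemma integral_completion_cong_AE:
  fixes f g :: "'a \<Rightarrow> real"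
  assumes "g \<in> borel_measurable M" "AE x in M. f x = g x"
  shows "integral\<^sup>L (completion M) f = integral\<^sup>L (completion M) g"
proof (rule integral_cong_AE)
  show g: "g \<in> borel_measurable (completion M)" using assms(1) by (rule measurable_completion)
  show "f \<in> borel_measurable (completion M)"
    using assms(2) by (intro borel_measurable_completion_cong_AE[OF g]) (auto elim!: eventually_mono)
  show "AE x in completion M. f x = g x" using assms(2) by (rule AE_completion)
qed

lemma gibbs_measure_cong:
  assumes [measurable]: "U' \<in> borel_measurable borel" "W' \<in> borel_measurable borel"
    and ae: "AE y in lborel. U y = U' y" "AE y in lborel. W y = W' y"
  shows "gibbs_measure \<beta> U W N = gibbs_measure \<beta> U' W' N"
proof -
  have m: "(\<lambda>x. exp (- \<beta> * energy U' W' N x)) \<in> borel_measurable (Pi\<^sub>M {..<N} (\<lambda>_. lborel))"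
    unfolding energy_def by measurable
  have "partition_function \<beta> U W N = partition_function \<beta> U' W' N"
    unfolding partition_function_def lebesgue_pow_def using energy_cong_AE[OF ae]
    by (intro integral_completion_cong_AE m) (auto elim!: eventually_mono)
  then show ?thesis
    unfolding gibbs_measure_def lebesgue_pow_def using energy_cong_AE[OF ae, of N]
    by (intro density_cong_AE AE_completion) (auto elim!: eventually_mono)
qed

text \<open>The equality holds at every point: for fixed x, the reflection y to x - y respects null
  sets.\<close>

lemma conv_cong:
  assumes [measurable]: "W' \<in> borel_measurable borel" "\<rho>' \<in> borel_measurable borel"
    and ae: "AE y in lborel. W y = W' y" "AE y in lborel. \<rho> y = \<rho>' y"
  shows "conv W \<rho> = conv W' \<rho>'"
proof
  fix x
  have "AE y in lborel. W (x + (-1) *\<^sub>R y) = W' (x + (-1) *\<^sub>R y)"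
    using ae(1) by (rule AE_lborel_affine) simp
  then have "AE y in lborel. W (x - y) * \<rho> y = W' (x - y) * \<rho>' y"
    using ae(2) by eventually_elim simp
  then show "conv W \<rho> x = conv W' \<rho>' x"
    unfolding conv_def by (intro integral_completion_cong_AE) measurable
qed

lemma free_energy_cong:
  assumes [measurable]: "W' \<in> borel_measurable borel" "\<rho>' \<in> borel_measurable borel"
    and ae: "AE y in lborel. U y = U' y" "AE y in lborel. W y = W' y" "AE y in lborel. \<rho> y = \<rho>' y"
  shows "free_energy \<beta> U W \<rho> = free_energy \<beta> U' W' \<rho>'"
proof -
  have "AE x in lborel. U x * \<rho> x + 1 / \<beta> * (\<rho> x * ln (\<rho> x)) = U' x * \<rho>' x + 1 / \<beta> * (\<rho>' x * ln (\<rho>' x))"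
    using ae(1,3) by eventually_elim simp
  then have "ext_integral lebesgue (\<lambda>x. U x * \<rho> x + 1 / \<beta> * (\<rho> x * ln (\<rho> x))) =
      ext_integral lebesgue (\<lambda>x. U' x * \<rho>' x + 1 / \<beta> * (\<rho>' x * ln (\<rho>' x)))"
    by (intro ext_integral_cong_AE AE_completion)
  moreover have "(\<integral>x. \<rho> x * conv W \<rho> x \<partial>lebesgue) = (\<integral>x. \<rho>' x * conv W' \<rho>' x \<partial>lebesgue)"
    unfolding conv_cong[OF assms(1,2) ae(2,3)] using ae(3)
    by (intro integral_completion_cong_AE) (auto elim!: eventually_mono)
  ultimately show ?thesis by (simp add: free_energy_def)
qed

subsection \<open>The entropy bound for Borel data\<close>

text \<open>The integrand and the indicator of a box factorise, so the two measures agree on boxes.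
  This determines the product of sigma-finite factors.\<close>

lemma (in product_sigma_finite) density_PiM:
  assumes I: "finite I" and f [measurable]: "\<And>i. i \<in> I \<Longrightarrow> f i \<in> borel_measurable (M i)"
    and D: "product_sigma_finite (\<lambda>i. density (M i) (f i))"
  shows "density (Pi\<^sub>M I M) (\<lambda>x. \<Prod>i\<in>I. f i (x i)) = Pi\<^sub>M I (\<lambda>i. density (M i) (f i))"
proof (rule product_sigma_finite.PiM_eqI[OF D I])
  have F: "(\<lambda>x. \<Prod>i\<in>I. f i (x i)) \<in> borel_measurable (Pi\<^sub>M I M)"
  proof (rule borel_measurable_prod_ennreal)
    fix i assume "i \<in> I"
    then show "(\<lambda>x. f i (x i)) \<in> borel_measurable (Pi\<^sub>M I M)"
      by (intro measurable_compose[OF _ f]) auto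
  qed
  show "sets (density (Pi\<^sub>M I M) (\<lambda>x. \<Prod>i\<in>I. f i (x i))) = sets (Pi\<^sub>M I (\<lambda>i. density (M i) (f i)))"
    unfolding sets_density by (rule sets_PiM_cong) auto
  fix A assume "\<And>i. i \<in> I \<Longrightarrow> A i \<in> sets (density (M i) (f i))"
  then have A: "\<And>i. i \<in> I \<Longrightarrow> A i \<in> sets (M i)" by simp
  have "emeasure (density (Pi\<^sub>M I M) (\<lambda>x. \<Prod>i\<in>I. f i (x i))) (Pi\<^sub>E I A) =
      (\<integral>\<^sup>+x. (\<Prod>i\<in>I. f i (x i)) * indicator (Pi\<^sub>E I A) x \<partial>Pi\<^sub>M I M)"
    using A I by (intro emeasure_density F sets_PiM_I_finite) auto
  also have "\<dots> = (\<integral>\<^sup>+x. (\<Prod>i\<in>I. f i (x i) * indicator (A i) (x i)) \<partial>Pi\<^sub>M I M)"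
  proof (rule nn_integral_cong)
    fix x assume "x \<in> space (Pi\<^sub>M I M)"
    then have "indicator (Pi\<^sub>E I A) x = (\<Prod>i\<in>I. indicator (A i) (x i) :: ennreal)"
      using I by (auto simp: indicator_def PiE_iff space_PiM prod_zero_iff)
    then show "(\<Prod>i\<in>I. f i (x i)) * indicator (Pi\<^sub>E I A) x = (\<Prod>i\<in>I. f i (x i) * indicator (A i) (x i))"
      by (simp add: prod.distrib)
  qed
  also have "\<dots> = (\<Prod>i\<in>I. \<integral>\<^sup>+y. f i y * indicator (A i) y \<partial>M i)"
    using A by (intro product_nn_integral_prod I) auto
  also have "\<dots> = (\<Prod>i\<in>I. emeasure (density (M i) (f i)) (A i))"
    using A by (intro prod.cong) (auto simp: emeasure_density)
  finally show "emeasure (density (Pi\<^sub>M I M) (\<lambda>x. \<Prod>i\<in>I. f i (x i))) (Pi\<^sub>E I A) =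
      (\<Prod>i\<in>I. emeasure (density (M i) (f i)) (A i))" .
qed

text \<open>The Euler-Lagrange equation holds at every point, so that the N-body weight can be
  rewritten as an exact identity.\<close>

locale self_consistent_density = mean_field \<beta> w U W
  for \<beta> w :: real and U W :: "real^'d \<Rightarrow> real" +
  fixes m :: "real^'d \<Rightarrow> real"
  assumes m: "density_on m" and m_eq: "m = tilted_density m"
begin

lemmas m_measurable [measurable] = density_onD(1)[OF m]

abbreviation "V \<equiv> conv W m"
abbreviation "D \<equiv> density lborel (\<lambda>x. ennreal (m x))"

text \<open>The Hoeffding projection of the interaction: both conditional means are removed and the
  total mean is restored. Each of the four terms is bounded by \<open>w\<close>.\<close>

definition centered_kernel :: "real^'d \<Rightarrow> real^'d \<Rightarrow> real" where
  "centered_kernel x y = W (x - y) - V x - V y + interaction m m"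

lemma V_measurable: "V \<in> borel_measurable borel" by measurable

lemma prob_space_D: "prob_space D"
proof (rule prob_spaceI)
  show "emeasure D (space D) = 1"
    using m by (simp add: emeasure_density density_on_def prob_density_def nn_integral_completion
        cong: nn_integral_cong)
qed

lemma integral_D: "f \<in> borel_measurable borel \<Longrightarrow> (\<integral>x. f x \<partial>D) = (\<integral>x. m x * f x \<partial>lborel)"
  for f :: "real^'d \<Rightarrow> real"
  by (subst integral_density) (auto simp: density_onD(2)[OF m])

lemma centered_kernel_sym: "centered_kernel x y = centered_kernel y x"
  by (simp add: centered_kernel_def W_diff_sym[of x y])

lemma degenerate: "degenerate_kernel D centered_kernel (4 * w)"
proof -
  interpret D: prob_space D by (rule prob_space_D)
  have [measurable]: "V \<in> borel_measurable borel" by (rule V_measurable)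
  have right: "(\<integral>y. centered_kernel x y \<partial>D) = 0" for x
  proof -
    have iV: "integrable D V" using conv_bound[OF m] by (intro D.integrable_bounded[where K = w]) auto
    have iW: "integrable D (\<lambda>y. W (x - y))" using W_bound by (intro D.integrable_bounded[where K = w]) auto
    have "(\<integral>y. centered_kernel x y \<partial>D) = (\<integral>y. W (x - y) \<partial>D) - V x - (\<integral>y. V y \<partial>D) + interaction m m"
      unfolding centered_kernel_def using iV iW by (simp add: D.prob_space[simplified])
    also have "(\<integral>y. V y \<partial>D) = interaction m m"
      by (subst integral_D) (auto simp: interaction_def)
    also have "(\<integral>y. W (x - y) \<partial>D) = V x"
      by (subst integral_D) (auto simp: conv_borel mult.commute)
    finally show ?thesis by simp
  qed
  show ?thesis
  proof
    have "case_prod centered_kernel \<in> borel_measurable (borel \<Otimes>\<^sub>M borel)"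
      unfolding centered_kernel_def by measurable
    then show "case_prod centered_kernel \<in> borel_measurable (D \<Otimes>\<^sub>M D)"
      by (subst measurable_cong_sets[OF sets_pair_measure_cong refl, of _ borel _ borel]) auto
    show "\<bar>centered_kernel x y\<bar> \<le> 4 * w" for x y
      unfolding centered_kernel_def
      using W_bound[of "x - y"] conv_bound[OF m, of x] conv_bound[OF m, of y] interaction_bound[OF m m]
      by linarith
    show "(\<integral>y. centered_kernel x y \<partial>D) = 0" for x by (rule right)
    show "(\<integral>x. centered_kernel x y \<partial>D) = 0" for y
      using right[of y] by (simp add: centered_kernel_sym[of _ y])
  qed
qed

interpretation degenerate_kernel D centered_kernel "4 * w" by (rule degenerate)

text \<open>Each V (x i) occurs in 2 (N - 1) of the ordered pairs, which the prefactor turns into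
  exactly one V (x i). It joins U (x i) to form the effective potential of \<open>m\<close>.\<close>

lemma energy_eq:
  assumes "N \<ge> 2"
  shows "energy U W N x = (\<Sum>i<N. U (x i) + V (x i)) +
    1 / (2 * (real N - 1)) * pair_sum {..<N} x - real N / 2 * interaction m m"
proof -
  have N: "real N - 1 > 0" using assms by simp
  let ?E = "\<Sum>i<N. \<Sum>j\<in>{..<N} - {i}. W (x i - x j)"
  have solve: "1 / (2 * a) * E = 1 / (2 * a) * p + S - n / 2 * c"
    if "E = p + 2 * a * S - n * a * c" "a > 0" for E p S a n c :: real
    using that by (simp add: field_simps)
  have card: "real (card ({..<N} - {i})) = real N - 1" if "i < N" for i using that by (simp add: of_nat_diff)
  have row: "(\<Sum>j\<in>{..<N} - {i}. V (x i) + V (x j)) = (real N - 1) * V (x i) + ((\<Sum>j<N. V (x j)) - V (x i))"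
    if "i < N" for i
    using that by (simp add: sum.distrib sum_diff1 of_nat_diff)
  have "pair_sum {..<N} x = (\<Sum>i<N. \<Sum>j\<in>{..<N} - {i}. centered_kernel (x i) (x j))"
  proof -
    have "edges {..<N} = (SIGMA i:{..<N}. {..<N} - {i})" by (auto simp: edges_def)
    then show ?thesis by (simp add: pair_sum_def sum.Sigma case_prod_unfold)
  qed
  also have "\<dots> = ?E - (\<Sum>i<N. \<Sum>j\<in>{..<N} - {i}. V (x i) + V (x j)) + real N * (real N - 1) * interaction m m"
    by (simp add: centered_kernel_def sum.distrib sum_subtractf card algebra_simps)
  also have "(\<Sum>i<N. \<Sum>j\<in>{..<N} - {i}. V (x i) + V (x j)) = 2 * (real N - 1) * (\<Sum>i<N. V (x i))"
  proof -
    have "(\<Sum>i<N. \<Sum>j\<in>{..<N} - {i}. V (x i) + V (x j)) =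
        (\<Sum>i<N. (real N - 1) * V (x i) + ((\<Sum>j<N. V (x j)) - V (x i)))"
      by (intro sum.cong row) auto
    then show ?thesis by (simp add: sum.distrib sum_subtractf sum_distrib_left[symmetric] algebra_simps)
  qed
  finally have "?E = pair_sum {..<N} x + 2 * (real N - 1) * (\<Sum>i<N. V (x i)) - real N * (real N - 1) * interaction m m"
    by simp
  then have "1 / (2 * (real N - 1)) * ?E = 1 / (2 * (real N - 1)) * pair_sum {..<N} x + (\<Sum>i<N. V (x i)) - real N / 2 * interaction m m"
    using N solve by blast
  then show ?thesis by (simp add: energy_def sum.distrib)
qed

section \<open>The product measure and the Gibbs measure relative to it\<close>

definition weight :: "nat \<Rightarrow> (nat \<Rightarrow> real^'d) \<Rightarrow> real" where
  "weight N x = (\<Prod>i<N. m (x i))"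

lemma weight_measurable [measurable]: "weight N \<in> borel_measurable (Pi\<^sub>M {..<N} (\<lambda>_. lborel))"
  unfolding weight_def by measurable

lemma weight_nonneg: "weight N x \<ge> 0"
  unfolding weight_def by (intro prod_nonneg) (auto simp: density_onD(2)[OF m])

lemma density_weight: "density (Pi\<^sub>M {..<N} (\<lambda>_. lborel)) (\<lambda>x. ennreal (weight N x)) = Pi\<^sub>M {..<N} (\<lambda>_. D)"
proof -
  interpret product_sigma_finite "\<lambda>_::nat. lborel :: (real^'d) measure" by standard
  have "product_sigma_finite (\<lambda>_::nat. D)"
    using prob_space_D by (simp add: product_sigma_finite_def prob_space_imp_sigma_finite)
  then show ?thesis
    using density_PiM[of "{..<N}" "\<lambda>_ y. ennreal (m y)"] density_onD(2)[OF m]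
    by (simp add: weight_def prod_ennreal)
qed

lemma prob_space_tensor: "prob_space (tensor_measure m N)"
proof (rule prob_spaceI)
  interpret P: prob_space "Pi\<^sub>M {..<N} (\<lambda>_. D)" by (rule prob_space_PiM) (rule prob_space_D)
  have "emeasure (tensor_measure m N) (space (tensor_measure m N)) =
      (\<integral>\<^sup>+x. ennreal (weight N x) \<partial>lebesgue_pow N)"
  proof -
    have "(\<lambda>x. ennreal (weight N x)) \<in> borel_measurable (lebesgue_pow N)"
      unfolding lebesgue_pow_def by (rule measurable_completion) measurable
    then show ?thesis
      by (simp add: tensor_measure_def emeasure_density weight_def[symmetric] cong: nn_integral_cong)
  qed
  also have "\<dots> = (\<integral>\<^sup>+x. ennreal (weight N x) \<partial>Pi\<^sub>M {..<N} (\<lambda>_. lborel))"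
    by (simp add: lebesgue_pow_def nn_integral_completion)
  also have "\<dots> = emeasure (density (Pi\<^sub>M {..<N} (\<lambda>_. lborel)) (\<lambda>x. ennreal (weight N x))) (space (Pi\<^sub>M {..<N} (\<lambda>_. lborel)))"
    by (simp add: emeasure_density cong: nn_integral_cong)
  also have "\<dots> = 1"
    unfolding density_weight using P.emeasure_space_1 by (simp add: space_PiM)
  finally show "emeasure (tensor_measure m N) (space (tensor_measure m N)) = 1" .
qed

text \<open>The tensor measure lives on the completion, while the exponential moments are bounded on
  the plain product of \<open>D\<close>. The first equation serves the partition function, the
  second the moments.\<close>

lemma integral_tensor:
  fixes f :: "(nat \<Rightarrow> real^'d) \<Rightarrow> real"
  assumes [measurable]: "f \<in> borel_measurable (Pi\<^sub>M {..<N} (\<lambda>_. lborel))"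
  shows "(\<integral>x. f x \<partial>tensor_measure m N) = (\<integral>x. weight N x * f x \<partial>lebesgue_pow N)"
    and "(\<integral>x. f x \<partial>tensor_measure m N) = (\<integral>x. f x \<partial>Pi\<^sub>M {..<N} (\<lambda>_. D))"
proof -
  show 1: "(\<integral>x. f x \<partial>tensor_measure m N) = (\<integral>x. weight N x * f x \<partial>lebesgue_pow N)"
    unfolding tensor_measure_def weight_def[symmetric] lebesgue_pow_def
    by (subst integral_density) (auto simp: weight_nonneg intro!: measurable_completion)
  also have "\<dots> = (\<integral>x. weight N x * f x \<partial>Pi\<^sub>M {..<N} (\<lambda>_. lborel))"
    unfolding lebesgue_pow_def by (rule integral_completion) measurable
  also have "\<dots> = (\<integral>x. f x \<partial>Pi\<^sub>M {..<N} (\<lambda>_. D))"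
    unfolding density_weight[symmetric] by (subst integral_density) (auto simp: weight_nonneg)
  finally show "(\<integral>x. f x \<partial>tensor_measure m N) = (\<integral>x. f x \<partial>Pi\<^sub>M {..<N} (\<lambda>_. D))" .
qed

lemma pair_sum_measurable_lborel [measurable]:
  "pair_sum {..<N} \<in> borel_measurable (Pi\<^sub>M {..<N} (\<lambda>_. lborel))"
  using pair_sum_measurable[of "{..<N}"]
  by (subst measurable_cong_sets[OF sets_PiM_cong refl, of _ _ _ "\<lambda>_. D"]) auto

text \<open>By \<open>energy_eq\<close> and the fixed point equation, the Boltzmann factor is
  \<open>weight\<close> times exp g up to a constant, which the normalisation cancels.\<close>

lemma gibbs_measure_eq:
  assumes "N \<ge> 2"
  defines "g \<equiv> \<lambda>x. - \<beta> / (2 * (real N - 1)) * pair_sum {..<N} x"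
  shows "gibbs_measure \<beta> U W N = density (tensor_measure m N)
    (\<lambda>x. ennreal (exp (g x) / (\<integral>x. exp (g x) \<partial>tensor_measure m N)))"
proof -
  define K where "K = tilted_partition m ^ N * exp (\<beta> * (real N / 2 * interaction m m))"
  have K: "K > 0" unfolding K_def using tilted_partition_pos[OF m] by simp
  define c where "c = (\<integral>x. exp (g x) \<partial>tensor_measure m N)"
  have [measurable]: "g \<in> borel_measurable (Pi\<^sub>M {..<N} (\<lambda>_. lborel))" unfolding g_def by measurable
  have e: "exp (- \<beta> * energy U W N x) = K * (weight N x * exp (g x))" for x
  proof -
    have S: "(\<Sum>i<N. - \<beta> * (U (x i) + V (x i))) = - \<beta> * (\<Sum>i<N. U (x i) + V (x i))"
      by (simp only: sum_distrib_left)
    have "weight N x = exp (\<Sum>i<N. - \<beta> * (U (x i) + V (x i))) / tilted_partition m ^ N"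
      unfolding weight_def by (subst m_eq) (simp add: tilted_density_def prod_dividef exp_sum)
    moreover have "- \<beta> * energy U W N x = \<beta> * (real N / 2 * interaction m m) +
        ((\<Sum>i<N. - \<beta> * (U (x i) + V (x i))) + g x)"
      unfolding energy_eq[OF assms(1)] g_def S by (simp add: algebra_simps)
    ultimately show ?thesis
      using tilted_partition_pos[OF m] by (simp add: K_def exp_add)
  qed
  have pf: "partition_function \<beta> U W N = K * c"
    unfolding partition_function_def e c_def by (simp add: integral_tensor(1))
  have "exp (- \<beta> * energy U W N x) / partition_function \<beta> U W N = weight N x * (exp (g x) / c)" for x
    unfolding e pf using K by simp
  moreover have c0: "c \<ge> 0" unfolding c_def by (intro integral_nonneg_AE) auto
  ultimately have "ennreal (exp (- \<beta> * energy U W N x) / partition_function \<beta> U W N) =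
      ennreal (weight N x) * ennreal (exp (g x) / c)" for x
    using weight_nonneg by (simp only: ennreal_mult divide_nonneg_nonneg exp_ge_zero)
  then have "gibbs_measure \<beta> U W N =
      density (lebesgue_pow N) (\<lambda>x. ennreal (weight N x) * ennreal (exp (g x) / c))"
    by (simp only: gibbs_measure_def)
  also have "\<dots> = density (tensor_measure m N) (\<lambda>x. ennreal (exp (g x) / c))"
    unfolding tensor_measure_def weight_def[symmetric] lebesgue_pow_def
    by (rule density_density_eq[symmetric]) (auto intro!: measurable_completion)
  finally show ?thesis by (simp add: c_def)
qed

lemma scaled_relative_entropy_bound:
  assumes small: "36/5 * \<beta> * w < 1"
  shows "\<exists>C N0. N0 > 0 \<and> (\<forall>N>N0. scaled_relative_entropy N (gibbs_measure \<beta> U W N) (tensor_measure m N) \<le> ereal (C / real N))"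
proof -
  define \<delta> where "\<delta> = 1 - 36/5 * \<beta> * w"
  have \<delta>: "0 < \<delta>" "\<delta> \<le> 1" using small beta_pos w_nonneg by (auto simp: \<delta>_def)
  \<comment> \<open>This is (1 + \<delta>) (1 - \<delta>) (1 + \<delta>^2): the order of the moment,
    the value of 36/5 \<beta> w, and room for N / (N - 1).\<close>
  define q where "q = 1 - \<delta> ^ 4"
  define L where "L = 1 + exp 1 * (\<Sum>k. real k * q ^ k)"
  \<comment> \<open>N > N0 gives N - 1 \<ge> N0, hence 1 / (N - 1) \<le> \<delta>^2.\<close>
  obtain N0 :: nat where N0: "1 / \<delta>\<^sup>2 \<le> real N0" using real_arch_simple by blast
  have "scaled_relative_entropy N (gibbs_measure \<beta> U W N) (tensor_measure m N) \<le> ereal (ln L / \<delta> / real N)"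
    if "N > max 1 N0" for N
  proof -
    have N: "N \<ge> 2" "real N - 1 \<ge> real N0" "real N - 1 > 0" using that by auto
    interpret \<nu>: prob_space "tensor_measure m N" by (rule prob_space_tensor)
    define t where "t = - \<beta> / (2 * (real N - 1))"
    have [measurable]: "pair_sum {..<N} \<in> borel_measurable (tensor_measure m N)"
      unfolding tensor_measure_def lebesgue_pow_def
      by (simp add: measurable_completion)
    have "relative_entropy (density (tensor_measure m N) (\<lambda>x. ennreal (exp (t * pair_sum {..<N} x) /
        (\<integral>x. exp (t * pair_sum {..<N} x) \<partial>tensor_measure m N)))) (tensor_measure m N) \<le> ereal (ln L / \<delta>)"
    proof (rule \<nu>.relative_entropy_tilted_le)
      show "\<bar>t * pair_sum {..<N} x\<bar> \<le> \<bar>t\<bar> * (4 * w * card (edges {..<N}))"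
        if "x \<in> space (tensor_measure m N)" for x
        unfolding abs_mult using that
        by (intro mult_left_mono pair_sum_bound) (auto simp: tensor_measure_def lebesgue_pow_def space_PiM)
      have "(\<integral>x. pair_sum {..<N} x \<partial>Pi\<^sub>M {..<N} (\<lambda>_. D)) = 0"
        by (rule pair_sum_integral) simp
      then show "(\<integral>x. t * pair_sum {..<N} x \<partial>tensor_measure m N) = 0"
        by (simp add: integral_tensor(2))
      have "(\<integral>x. exp ((1 + \<delta>) * (t * pair_sum {..<N} x)) \<partial>tensor_measure m N) =
          (\<integral>x. exp (((1 + \<delta>) * t) * pair_sum {..<N} x) \<partial>Pi\<^sub>M {..<N} (\<lambda>_. D))"
        by (subst integral_tensor(2)) (auto simp: mult.assoc)
      also have "\<dots> \<le> L"
        unfolding L_def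
      proof (rule pair_sum_exp_bound)
        show "{..<N} \<noteq> {}" using N by (auto simp: lessThan_empty_iff)
        show "q < 1" using \<delta> by (simp add: q_def)
        have "real N / (real N - 1) = 1 + 1 / (real N - 1)" using N by (simp add: field_simps)
        also have "\<dots> \<le> 1 + \<delta>\<^sup>2"
        proof -
          have "1 / \<delta>\<^sup>2 \<le> real N - 1" using N0 N by linarith
          then show ?thesis using \<delta> N by (simp add: field_simps)
        qed
        finally have r: "real N / (real N - 1) \<le> 1 + \<delta>\<^sup>2" .
        \<comment> \<open>The constant 18/5 times the kernel bound 4 w, halved by the denominator of
          \<open>t\<close>, gives 36/5 w.\<close>
        have "18/5 * \<bar>(1 + \<delta>) * t\<bar> * (4 * w) * real (card {..<N}) =
            (1 + \<delta>) * (1 - \<delta>) * (real N / (real N - 1))"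
          using \<delta> N beta_pos by (simp add: t_def \<delta>_def abs_mult field_simps)
        also have "\<dots> \<le> (1 + \<delta>) * (1 - \<delta>) * (1 + \<delta>\<^sup>2)"
          using \<delta> r by (intro mult_left_mono) auto
        also have "\<dots> = q" by (simp add: q_def algebra_simps power2_eq_square power4_eq_xxxx)
        finally show "18/5 * \<bar>(1 + \<delta>) * t\<bar> * (4 * w) * real (card {..<N}) \<le> q" .
      qed simp
      finally show "(\<integral>x. exp ((1 + \<delta>) * (t * pair_sum {..<N} x)) \<partial>tensor_measure m N) \<le> L" .
    qed (use \<delta> in measurable)
    then have "relative_entropy (gibbs_measure \<beta> U W N) (tensor_measure m N) \<le> ereal (ln L / \<delta>)"
      unfolding gibbs_measure_eq[OF N(1)] t_def .
    then have "scaled_relative_entropy N (gibbs_measure \<beta> U W N) (tensor_measure m N) \<le> ereal (ln L / \<delta>) / ereal (real N)"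
      unfolding scaled_relative_entropy_def using N by (intro ereal_divide_right_mono) auto
    then show ?thesis using N by simp
  qed
  then show ?thesis by (intro exI[of _ "ln L / \<delta>"] exI[of _ "max 1 N0"]) auto
qed

end

section \<open>From the hypotheses of the theorem to Borel data\<close>

lemma integrable_exp_potential:
  fixes U W :: "real^'d \<Rightarrow> real"
  assumes \<beta>: "\<beta> > 0" and [measurable]: "U \<in> borel_measurable borel" "W \<in> borel_measurable borel"
    and W: "\<And>x. \<bar>W x\<bar> \<le> w"
    and int: "integrable (Pi\<^sub>M {..<2} (\<lambda>_. lborel)) (\<lambda>x. exp (- \<beta> * energy U W 2 x))"
  shows "integrable lborel (\<lambda>x. exp (- \<beta> * U x))"
proof -
  interpret product_sigma_finite "\<lambda>_::nat. lborel :: (real^'d) measure" by standard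
  let ?P = "Pi\<^sub>M {..<2} (\<lambda>_::nat. lborel :: (real^'d) measure)"
  \<comment> \<open>For two particles the interaction term is at most \<open>w\<close>, so the
    product of the one-body factors is dominated by an integrable function. By Tonelli's theorem the
    product integrates to the square of the one-body integral.\<close>
  have le: "(\<Prod>i<2. exp (- \<beta> * U (x i))) \<le> exp (\<beta> * w) * exp (- \<beta> * energy U W 2 x)" for x
  proof -
    have "{..<2::nat} - {0} = {1}" "{..<2::nat} - {1} = {0}" "{..<2::nat} = {0, 1}" by auto
    then have "energy U W 2 x = U (x 0) + U (x 1) + 1 / 2 * (W (x 0 - x 1) + W (x 1 - x 0))"
      by (simp add: energy_def)
    also have "\<dots> \<le> U (x 0) + U (x 1) + w"
      using W[of "x 0 - x 1"] W[of "x 1 - x 0"] by simp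
    finally have "\<beta> * energy U W 2 x \<le> \<beta> * (U (x 0) + U (x 1) + w)" using \<beta> by simp
    then show ?thesis by (simp add: numeral_2_eq_2 exp_add[symmetric] algebra_simps)
  qed
  have "(\<integral>\<^sup>+y. ennreal (exp (- \<beta> * U y)) \<partial>lborel) ^ 2 =
      (\<integral>\<^sup>+x. (\<Prod>i<2. ennreal (exp (- \<beta> * U (x i)))) \<partial>?P)"
    by (subst product_nn_integral_prod) auto
  also have "\<dots> = (\<integral>\<^sup>+x. ennreal (\<Prod>i<2. exp (- \<beta> * U (x i))) \<partial>?P)"
    by (simp add: prod_ennreal)
  also have "\<dots> \<le> (\<integral>\<^sup>+x. ennreal (exp (\<beta> * w) * exp (- \<beta> * energy U W 2 x)) \<partial>?P)"
    by (intro nn_integral_mono ennreal_leI le)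
  also have "\<dots> < \<infinity>"
  proof -
    have "integrable ?P (\<lambda>x. exp (\<beta> * w) * exp (- \<beta> * energy U W 2 x))" using int by auto
    then have "(\<integral>\<^sup>+x. ennreal (exp (\<beta> * w) * exp (- \<beta> * energy U W 2 x)) \<partial>?P) \<noteq> \<infinity>"
      unfolding real_integrable_def by blast
    then show ?thesis by (simp only: less_top infinity_ennreal_def)
  qed
  finally have fin: "(\<integral>\<^sup>+y. ennreal (exp (- \<beta> * U y)) \<partial>lborel) ^ 2 < \<infinity>" .
  have "x < \<infinity>" if "x ^ 2 < \<infinity>" for x :: ennreal
    using that by (cases x) (auto simp: power2_eq_square)
  from this[OF fin] show ?thesis by (intro integrableI_nonneg) auto
qed

text \<open>For w > 0 the quotient is an ordinary real one, and 8/3 \<le> e and 7/5 \<le> sqrt 2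
  give 2 e sqrt 2 \<ge> 112/15 > 36/5. For w = 0 the conclusion is immediate.\<close>

lemma temperature_bound:
  assumes "\<beta> > 0" "w \<ge> 0" "ereal \<beta> < 1 / (ereal (2 * exp 1 * sqrt 2) * ereal w)"
  shows "36/5 * \<beta> * w < 1"
proof (cases "w = 0")
  case False
  then have w: "w > 0" using assms by simp
  let ?c = "2 * exp 1 * sqrt 2 :: real"
  have "8/3 \<le> exp (1::real)"
    using e_approx_32 by (simp add: abs_if split: if_split_asm)
  moreover have "7/5 \<le> sqrt 2" by (rule real_le_rsqrt) (simp add: power2_eq_square)
  ultimately have "2 * (8/3) * (7/5) \<le> ?c" by (intro mult_mono) auto
  then have c: "36/5 \<le> ?c" by simp
  have "\<beta> < 1 / (?c * w)" using assms(3) w by (simp add: one_ereal_def)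
  then have "?c * (\<beta> * w) < 1" using w c by (simp add: field_simps)
  moreover have "36/5 * (\<beta> * w) \<le> ?c * (\<beta> * w)"
    using c assms w by (intro mult_right_mono) auto
  ultimately have "36/5 * (\<beta> * w) < 1" by (rule le_less_trans[rotated])
  then show ?thesis by (simp only: mult.assoc)
qed simp

theorem theorem3p1:
  fixes \<beta> :: real and U W \<rho> :: "real^'d \<Rightarrow> real"
  assumes "\<beta> > 0"
    and "U \<in> borel_measurable lebesgue"
    and "in_Linf W"
    and "AE x in lebesgue. W (- x) = W x"
    and "\<And>N. N \<ge> 2 \<Longrightarrow> integrable (lebesgue_pow N) (\<lambda>x. exp (- \<beta> * energy U W N x))"
    and "ereal \<beta> < 1 / (ereal (2 * exp 1 * sqrt 2) * Linf_norm W)"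
    and "free_energy_minimizer \<beta> U W \<rho>"
  shows "\<exists>(C::real) (N0::nat). N0 > 0 \<and>
           (\<forall>N>N0. scaled_relative_entropy N (gibbs_measure \<beta> U W N) (tensor_measure \<rho> N)
                     \<le> ereal (C / real N))"
proof -
  obtain w where Linf: "Linf_norm W = ereal w" and w0: "w \<ge> 0"
    and w: "AE x in lborel. \<bar>W x\<bar> \<le> w"
  proof -
    \<comment> \<open>Lebesgue measure is nontrivial, so some point satisfies this bound. Hence the
      norm is nonnegative and, being finite, a real number.\<close>
    have ae: "AE x in lborel. ereal \<bar>W x\<bar> \<le> Linf_norm W"
      using esssup_AE[of "\<lambda>x. ereal \<bar>W x\<bar>" lebesgue] by (simp add: Linf_norm_def AE_completion_iff)
    moreover have "ae_filter (lborel :: (real^'d) measure) \<noteq> bot"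
      by (simp add: ae_filter_eq_bot_iff)
    ultimately obtain x where x: "ereal \<bar>W x\<bar> \<le> Linf_norm W"
      using eventually_happens' by blast
    have "Linf_norm W < \<infinity>" using assms(3) by (simp add: in_Linf_def)
    with x obtain w where "Linf_norm W = ereal w" by (cases "Linf_norm W") auto
    with x ae show ?thesis by (intro that[of w]) auto
  qed
  obtain U' where [measurable]: "U' \<in> borel_measurable borel" and U': "AE x in lborel. U x = U' x"
    using completion_ex_borel_measurable_real[OF assms(2)] by auto
  obtain W1 where [measurable]: "W1 \<in> borel_measurable borel" and W1: "AE x in lborel. W x = W1 x"
    using completion_ex_borel_measurable_real[of W lborel] assms(3) by (auto simp: in_Linf_def)
  \<comment> \<open>Averaging with the reflection and cutting off at \<open>w\<close> makes symmetry
    and the bound hold everywhere. Both operations leave \<open>W\<close> unchanged almost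
    everywhere.\<close>
  define W' where "W' x = max (- w) (min w ((W1 x + W1 (- x)) / 2))" for x
  have W'_measurable [measurable]: "W' \<in> borel_measurable borel" unfolding W'_def by measurable
  have "AE x in lborel. W (0 + (-1) *\<^sub>R x) = W1 (0 + (-1) *\<^sub>R x)"
    using W1 by (rule AE_lborel_affine) simp
  moreover have "AE x in lborel. W (- x) = W x" using assms(4) by (simp add: AE_completion_iff)
  ultimately have W': "AE x in lborel. W x = W' x"
    using W1 w by eventually_elim (auto simp: W'_def)
  have prob: "prob_density \<rho>" using assms(7) by (simp add: free_energy_minimizer_def)
  obtain \<rho>1 where [measurable]: "\<rho>1 \<in> borel_measurable borel" and \<rho>1: "AE x in lborel. \<rho> x = \<rho>1 x"
    using completion_ex_borel_measurable_real[of \<rho> lborel] prob by (auto simp: prob_density_def)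
  define \<rho>' where "\<rho>' x = max 0 (\<rho>1 x)" for x
  have \<rho>'_measurable [measurable]: "\<rho>' \<in> borel_measurable borel" unfolding \<rho>'_def by measurable
  have \<rho>': "AE x in lborel. \<rho> x = \<rho>' x"
    using \<rho>1
  proof eventually_elim
    case (elim x)
    moreover have "\<rho> x \<ge> 0" using prob by (simp add: prob_density_def)
    ultimately show ?case by (simp add: \<rho>'_def)
  qed
  interpret mean_field \<beta> w U' W'
  proof
    show "\<bar>W' x\<bar> \<le> w" and "W' (- x) = W' x" for x using w0 by (auto simp: W'_def add.commute)
    show "integrable lborel (\<lambda>x. exp (- \<beta> * U' x))"
    proof (rule integrable_exp_potential)
      show "\<bar>W' x\<bar> \<le> w" for x using w0 by (auto simp: W'_def)
      have m: "(\<lambda>x. exp (- \<beta> * energy U' W' 2 x)) \<in> borel_measurable (Pi\<^sub>M {..<2} (\<lambda>_. lborel))"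
        unfolding energy_def by measurable
      have "integrable (completion (Pi\<^sub>M {..<2} (\<lambda>_. lborel))) (\<lambda>x. exp (- \<beta> * energy U' W' 2 x))"
      proof (rule integrable_cong_AE_imp)
        show "integrable (completion (Pi\<^sub>M {..<2} (\<lambda>_. lborel))) (\<lambda>x. exp (- \<beta> * energy U W 2 x))"
          using assms(5)[of 2] by (simp add: lebesgue_pow_def)
        show "AE x in completion (Pi\<^sub>M {..<2} (\<lambda>_. lborel)). exp (- \<beta> * energy U W 2 x) = exp (- \<beta> * energy U' W' 2 x)"
          using energy_cong_AE[OF U' W', of 2] by (intro AE_completion) (auto elim!: eventually_mono)
      qed (rule measurable_completion[OF m])
      then show "integrable (Pi\<^sub>M {..<2} (\<lambda>_. lborel)) (\<lambda>x. exp (- \<beta> * energy U' W' 2 x))"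
        using integrable_completion[OF m] by simp
    qed (use assms(1) in measurable)
  qed (use assms(1) in measurable)
  have \<rho>'_on: "density_on \<rho>'"
  proof -
    have "(\<integral>\<^sup>+x. ennreal (\<rho>' x) \<partial>lebesgue) = (\<integral>\<^sup>+x. ennreal (\<rho> x) \<partial>lebesgue)"
      using \<rho>' by (intro nn_integral_cong_AE AE_completion) (auto elim!: eventually_mono)
    also have "\<dots> = 1" using prob unfolding prob_density_def by blast
    finally have "(\<integral>\<^sup>+x. ennreal (\<rho>' x) \<partial>lebesgue) = 1" .
    moreover have "\<rho>' \<in> borel_measurable lebesgue" by (rule measurable_completion) simp
    moreover have "\<forall>x. 0 \<le> \<rho>' x" by (simp add: \<rho>'_def)
    ultimately show ?thesis
      unfolding density_on_def prob_density_def using \<rho>'_measurable by blast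
  qed
  \<comment> \<open>The function \<rho>' equals its tilted density only almost everywhere. Its image
    \<open>m\<close> is a fixed point at every point, because convolution does not see null
    sets.\<close>
  define m where "m = tilted_density \<rho>'"
  have m_on: "density_on m" unfolding m_def by (rule tilted_density_on[OF \<rho>'_on])
  have [measurable]: "m \<in> borel_measurable borel" by (rule density_onD(1)[OF m_on])
  have \<rho>'m: "AE x in lborel. \<rho>' x = m x"
    unfolding m_def
  proof (rule minimizer_eq_tilted_density[OF \<rho>'_on])
    fix \<sigma> assume "density_on \<sigma>"
    then have [measurable]: "\<sigma> \<in> borel_measurable borel" and "prob_density \<sigma>" by (auto simp: density_on_def)
    then have "free_energy \<beta> U W \<rho> \<le> free_energy \<beta> U W \<sigma>"
      using assms(7) by (simp add: free_energy_minimizer_def)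
    moreover have "free_energy \<beta> U W \<rho> = free_energy \<beta> U' W' \<rho>'"
      by (rule free_energy_cong[OF W'_measurable \<rho>'_measurable U' W' \<rho>'])
    moreover have "free_energy \<beta> U W \<sigma> = free_energy \<beta> U' W' \<sigma>"
      by (rule free_energy_cong[OF W'_measurable _ U' W']) auto
    ultimately show "free_energy \<beta> U' W' \<rho>' \<le> free_energy \<beta> U' W' \<sigma>" by simp
  qed
  have "conv W' \<rho>' = conv W' m" by (rule conv_cong) (use \<rho>'m in auto)
  then have m_eq: "m = tilted_density m"
    by (simp add: m_def tilted_density_def[abs_def] tilted_partition_def)
  interpret self_consistent_density \<beta> w U' W' m
    using m_on m_eq by unfold_locales
  have "AE x in lborel. \<rho> x = m x" using \<rho>' \<rho>'m by eventually_elim simp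
  then have "tensor_measure \<rho> N = tensor_measure m N" for N by (rule tensor_measure_cong)
  moreover have "gibbs_measure \<beta> U W N = gibbs_measure \<beta> U' W' N" for N
    by (rule gibbs_measure_cong) (use U' W' in auto)
  moreover have "36/5 * \<beta> * w < 1"
    using temperature_bound[OF assms(1) w0] assms(6) by (simp add: Linf)
  ultimately show ?thesis using scaled_relative_entropy_bound by simp
qed

end
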